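(* For all $k=\Omega(\log m)$ and all $n=\Omega(\sqrt{m/k})$, $\mathsf{MIR_{SubMod}}(m,k)=\Omega\big(\sqrt{m/(k\log(m/k))}\big)$. Explicitly: there are absolute constants $C,c>0$ such that for all $m$, all $k$ with $C\log m\le k\le m/2$, and all $n\ge C\sqrt{m/k}$, every maximal-in-range mechanism for $n$ bidders with monotone submodular valuations over $m$ items that uses at most $2^k$ bits of communication has approximation guarantee at least $c\sqrt{m/(k\log(m/k))}$. In particular, every maximal-in-range mechanism for submodular valuations using $\mathrm{poly}(m)$ communication has approximation guarantee $\Omega(\sqrt m/\log m)$.
   Context: Setting: items $M=[m]$, bidders $N=[n]$; bidder $i$ privately holds a monotone valuation $v_i:2^M\to\mathbb{R}_{\ge 0}$. An allocation is a tuple $A=(A_1,\dots,A_n)$ of pairwise disjoint subsets of $M$; its welfare is $\sum_i v_i(A_i)$. $\mathrm{OPT}(\vec v)$ is the maximum welfare over all allocations. An allocation bank $\mathcal A$ is a set of allocations, and $\mathrm{MIR}_{\mathcal A}(\vec v)=\max_{A\in\mathcal A}\sum_i v_i(A_i)$. The maximal-in-range (MIR) mechanism for $\mathcal A$ outputs, for every valuation profile, an allocation in $\mathcal A$ of maximum welfare among allocations in $\mathcal A$ (together with VCG payments, which make it truthful). It has approximation guarantee $\alpha$ (is $\alpha$-approximate) on a valuation class if $\mathrm{MIR}_{\mathcal A}(\vec v)\ge \mathrm{OPT}(\vec v)/\alpha$ for all profiles $\vec v$ from the class. Communication is the worst-case number of bits of a deterministic protocol among the bidders (blackboard model, bidder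 $i$ knows only $v_i$) that implements the mechanism on all profiles from the class. $\mathsf{MIR_{SubMod}}(m,k)$ is the best (smallest) approximation guarantee achievable by an MIR mechanism using at most $2^k$ communication between bidders with monotone submodular valuations over $m$ items. $\log$ is base 2. *)

theory Defs
  imports
    "HOL-Library.FuncSet"
    "HOL-Library.Disjoint_Sets"
    "HOL-Library.Extended_Real"
    "HOL-Computational_Algebra.Polynomial"
begin

text \<open>
  The items are \<open>{..<m}\<close> and the bidders \<open>{..<n}\<close>. Valuations, profiles and allocations are
  extensional functions, so that a bidder's private information consists of the values of the
  subsets of \<open>{..<m}\<close> and of nothing else.
\<close>

type_synonym valuation = "nat set \<Rightarrow> real"
type_synonym profile = "nat \<Rightarrow> valuation"
type_synonym allocation = "nat \<Rightarrow> nat set"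

definition submodular_on :: "'a set \<Rightarrow> ('a set \<Rightarrow> real) \<Rightarrow> bool" where
  "submodular_on M v \<longleftrightarrow> (\<forall>S\<subseteq>M. \<forall>T\<subseteq>M. v (S \<union> T) + v (S \<inter> T) \<le> v S + v T)"

text \<open>
  The parameter \<open>D\<close> is the set of admissible values (the numerical precision of the input);
  \<open>D = {0..}\<close> gives all monotone submodular \<open>v : 2\<^sup>M \<rightarrow> \<real>\<^sub>\<ge>\<^sub>0\<close>. Over that unrestricted class, comparing two
  values held by different bidders already needs an unbounded number of bits, so that bit
  complexity is only informative when it is also considered for bounded precision, such as
  \<open>D = real ` {0..2 ^ m}\<close>. No normalisation \<open>v {} = 0\<close> is imposed.
\<close>

definition submod_valuations :: "real set \<Rightarrow> nat \<Rightarrow> valuation set" where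
  "submod_valuations D m =
     {v \<in> Pow {..<m} \<rightarrow>\<^sub>E D. mono_on (Pow {..<m}) v \<and> submodular_on {..<m} v}"

definition submod_profiles :: "real set \<Rightarrow> nat \<Rightarrow> nat \<Rightarrow> profile set" where
  "submod_profiles D n m = ({..<n} \<rightarrow>\<^sub>E submod_valuations D m)"

definition allocations :: "nat \<Rightarrow> nat \<Rightarrow> allocation set" where
  "allocations n m = {A \<in> {..<n} \<rightarrow>\<^sub>E Pow {..<m}. disjoint_family_on A {..<n}}"

definition welfare :: "nat \<Rightarrow> profile \<Rightarrow> allocation \<Rightarrow> real" where
  "welfare n v A = (\<Sum>i<n. v i (A i))"

definition OPT :: "nat \<Rightarrow> nat \<Rightarrow> profile \<Rightarrow> real" where
  "OPT n m v = Max (welfare n v ` allocations n m)"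

definition MIR :: "nat \<Rightarrow> allocation set \<Rightarrow> profile \<Rightarrow> real" where
  "MIR n \<A> v = Max (welfare n v ` \<A>)"

definition allocation_bank :: "nat \<Rightarrow> nat \<Rightarrow> allocation set \<Rightarrow> bool" where
  "allocation_bank n m \<A> \<longleftrightarrow> \<A> \<noteq> {} \<and> \<A> \<subseteq> allocations n m"

text \<open>
  A mechanism is identified with its allocation rule \<open>f\<close>; the payments are the VCG payments
  determined by \<open>\<A>\<close> and play no role for the approximation guarantee.
\<close>

definition mir_mechanism ::
    "profile set \<Rightarrow> nat \<Rightarrow> nat \<Rightarrow> allocation set \<Rightarrow> (profile \<Rightarrow> allocation) \<Rightarrow> bool" where
  "mir_mechanism \<V> n m \<A> f \<longleftrightarrow>
     allocation_bank n m \<A> \<and> (\<forall>v\<in>\<V>. f v \<in> \<A> \<and> welfare n v (f v) = MIR n \<A> v)"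

definition approx_guarantee ::
    "profile set \<Rightarrow> nat \<Rightarrow> nat \<Rightarrow> allocation set \<Rightarrow> real \<Rightarrow> bool" where
  "approx_guarantee \<V> n m \<A> \<alpha> \<longleftrightarrow> 0 < \<alpha> \<and> (\<forall>v\<in>\<V>. OPT n m v / \<alpha> \<le> MIR n \<A> v)"

text \<open>
  Deterministic blackboard protocols. A node of the tree is the transcript so far; it determines
  who speaks next, and the bit written is a function of the speaker's private input only. The
  depth of the tree is the worst-case number of bits.
\<close>

datatype (speakers: 'i, dead 'v, outputs: 'o) protocol =
    Output 'o
  | Speak 'i "'v \<Rightarrow> bool" "('i, 'v, 'o) protocol" "('i, 'v, 'o) protocol"

primrec run :: "('i, 'v, 'o) protocol \<Rightarrow> ('i \<Rightarrow> 'v) \<Rightarrow> 'o" where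
  "run (Output a) v = a"
| "run (Speak i b P Q) v = (if b (v i) then run P v else run Q v)"

primrec bits :: "('i, 'v, 'o) protocol \<Rightarrow> nat" where
  "bits (Output a) = 0"
| "bits (Speak i b P Q) = Suc (max (bits P) (bits Q))"

definition uses_communication ::
    "profile set \<Rightarrow> nat \<Rightarrow> (profile \<Rightarrow> allocation) \<Rightarrow> nat \<Rightarrow> bool" where
  "uses_communication \<V> n f b \<longleftrightarrow>
     (\<exists>P :: (nat, valuation, allocation) protocol.
        speakers P \<subseteq> {..<n} \<and> bits P \<le> b \<and> (\<forall>v\<in>\<V>. run P v = f v))"

text \<open>The infimum is \<open>\<infinity>\<close> if no mechanism within the budget has a finite guarantee.\<close>

definition MIR_SubMod :: "real set \<Rightarrow> nat \<Rightarrow> nat \<Rightarrow> nat \<Rightarrow> ereal" where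
  "MIR_SubMod D n m k =
     Inf {ereal \<alpha> | \<alpha> \<A> f.
            mir_mechanism (submod_profiles D n m) n m \<A> f
          \<and> uses_communication (submod_profiles D n m) n f (2 ^ k)
          \<and> approx_guarantee (submod_profiles D n m) n m \<A> \<alpha>}"

end

theory Submission
  imports Defs "HOL-Real_Asymp.Real_Asymp"
begin

text \<open>
  Give every item to a random one of \<open>N\<close> bidders, each of whom counts the items he was meant to get.
  A bank with guarantee \<open>\<alpha>\<close> must agree with every such assignment on \<open>m / \<alpha>\<close> items, so for \<open>N\<close> a
  large multiple of \<open>\<alpha>\<close> a Natarajan-type counting bound yields a shattered set of more than
  \<open>(2 k + 1) (N - 1)\<close> items: each of them can go, independently of the others, to either of two bidders.
  This is a multigraph with the bidders as vertices and the items as edges. It is so dense that two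
  bidders \<open>u\<close> and \<open>v\<close> are joined by \<open>2 k + 2\<close> edge-disjoint paths. A bidder inside a path wants at least
  one of its two items there, and so transmits along the path the conflict between \<open>u\<close>, who wants
  the first item, and \<open>v\<close>, who wants the last. Thus \<open>u\<close> and \<open>v\<close> face a problem over all divisions of
  \<open>2 k + 2\<close> paths between them, into which set disjointness on the \<open>(k + 1)\<close>-subsets embeds; this needs
  more than \<open>2 ^ k\<close> bits.
\<close>

section \<open>Transcripts of protocols\<close>

primrec transcript :: "('i, 'v, 'o) protocol \<Rightarrow> ('i \<Rightarrow> 'v) \<Rightarrow> bool list" where
  "transcript (Output a) v = []"
| "transcript (Speak i b P Q) v =
     (if b (v i) then True # transcript P v else False # transcript Q v)"

lemma card_transcripts: "finite (range (transcript P)) \<and> card (range (transcript P)) \<le> 2 ^ bits P"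
proof (induction P)
  case (Output a)
  have "range (transcript (Output a :: ('a, 'b, 'c) protocol)) = {[]}" by auto
  then show ?case by simp
next
  case (Speak i b P Q)
  let ?A = "(#) True ` range (transcript P)" and ?B = "(#) False ` range (transcript Q)"
  have sub: "range (transcript (Speak i b P Q)) \<subseteq> ?A \<union> ?B" by auto
  have fin: "finite (?A \<union> ?B)" using Speak by auto
  have "card (?A \<union> ?B) \<le> card ?A + card ?B" by (rule card_Un_le)
  also have "\<dots> \<le> card (range (transcript P)) + card (range (transcript Q))"
    using Speak by (intro add_mono card_image_le) auto
  also have "\<dots> \<le> 2 ^ bits P + 2 ^ bits Q" using Speak by (intro add_mono) auto
  also have "\<dots> \<le> 2 ^ max (bits P) (bits Q) + 2 ^ max (bits P) (bits Q)"
    by (intro add_mono power_increasing) auto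
  also have "\<dots> = 2 ^ bits (Speak i b P Q)" by simp
  finally show ?case using card_mono[OF fin sub] finite_subset[OF sub fin] by auto
qed

text \<open>Every bit is a function of one private input, so the inputs that reach a given leaf form
  a product set: each coordinate may be taken from either of two inputs reaching it.\<close>

lemma transcript_rectangle:
  assumes "transcript P v = transcript P v'" "\<And>i. w i = v i \<or> w i = v' i"
  shows "transcript P w = transcript P v \<and> run P w = run P v"
  using assms(1)
proof (induction P)
  case (Speak i b P Q)
  then show ?case using assms(2)[of i] by (auto split: if_splits)
qed auto

lemma transcript_collision:
  assumes "2 ^ bits P < card K"
  obtains x y where "x \<in> K" "y \<in> K" "x \<noteq> y" "transcript P (h x) = transcript P (h y)"
proof -
  have "card ((\<lambda>x. transcript P (h x)) ` K) \<le> card (range (transcript P))"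
    using card_transcripts by (intro card_mono) auto
  then have "card ((\<lambda>x. transcript P (h x)) ` K) < card K"
    using assms card_transcripts[of P] by linarith
  then have "\<not> inj_on (\<lambda>x. transcript P (h x)) K" by (rule pigeonhole)
  then show ?thesis using that unfolding inj_on_def by blast
qed

section \<open>Shattering by partial functions\<close>

text \<open>Natarajan shattering for partial functions, with \<open>p\<close> and \<open>q\<close>
  as the two colours. The mixtures must have domain exactly \<open>S\<close>; for a down-closed
  family this is equivalent to each of them extending to a member.\<close>

definition shatters :: "('a \<rightharpoonup> 'b) set \<Rightarrow> 'a set \<Rightarrow> ('a \<Rightarrow> 'b) \<Rightarrow> ('a \<Rightarrow> 'b) \<Rightarrow> bool" where
  "shatters F S p q \<longleftrightarrow> (\<forall>x\<in>S. p x \<noteq> q x) \<and>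
     (\<forall>g. dom g = S \<longrightarrow> (\<forall>x\<in>S. g x = Some (p x) \<or> g x = Some (q x)) \<longrightarrow> g \<in> F)"

lemma finite_partial_functions:
  assumes "finite U" "finite B"
  shows "finite {g :: 'a \<rightharpoonup> 'b. dom g \<subseteq> U \<and> ran g \<subseteq> B}"
proof -
  have "{g :: 'a \<rightharpoonup> 'b. dom g \<subseteq> U \<and> ran g \<subseteq> B} = (\<Union>D\<in>Pow U. {g. dom g = D \<and> ran g \<subseteq> B})"
    by auto
  then show ?thesis using assms
    by (auto intro!: finite_set_of_finite_maps intro: finite_subset)
qed

lemma nat_le_Suc_pairs: "(r::nat) \<le> 1 + r * (r - 1)"
  by (cases r; cases "r - 1") auto

lemma card_le_distinct_pairs:
  assumes "finite R"
  shows "card R \<le> 1 + card {(a, b). a \<in> R \<and> b \<in> R \<and> a \<noteq> b}"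
proof -
  have "{(a, b). a \<in> R \<and> b \<in> R \<and> a \<noteq> b} = (SIGMA a:R. R - {a})" by auto
  then have "card {(a, b). a \<in> R \<and> b \<in> R \<and> a \<noteq> b} = (\<Sum>a\<in>R. card (R - {a}))"
    using assms by (simp add: card_SigmaI)
  also have "\<dots> = card R * (card R - 1)" using assms by simp
  finally show ?thesis using nat_le_Suc_pairs[of "card R"] by simp
qed

text \<open>
  A Sauer--Shelah--Natarajan bound for down-closed families of partial functions: splitting on an
  element \<open>x\<close> and bounding the number \<open>r\<close> of possible values at \<open>x\<close> by \<open>1 + r (r - 1)\<close>, every
  ordered pair of distinct values at \<open>x\<close> passes to a family of smaller dimension.
\<close>

lemma natarajan_weight_bound:
  fixes F :: "('a \<rightharpoonup> 'b) set" and w :: real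
  assumes "finite U" "finite B" "B \<noteq> {}" "0 \<le> w"
    and "F \<subseteq> {g. dom g \<subseteq> U \<and> ran g \<subseteq> B}"
    and "\<And>g g'. g \<in> F \<Longrightarrow> g' \<subseteq>\<^sub>m g \<Longrightarrow> g' \<in> F"
    and "\<And>S p q. shatters F S p q \<Longrightarrow> S \<subseteq> U \<Longrightarrow> p ` S \<subseteq> B \<Longrightarrow> q ` S \<subseteq> B \<Longrightarrow> card S \<le> d"
  shows "(\<Sum>g\<in>F. w ^ card (dom g)) \<le> (1 + 2 * w) ^ card U * real (card B) ^ (2 * d)"
  using assms(1,5-)
proof (induction U arbitrary: F d rule: finite_induct)
  case empty
  have "F \<subseteq> {Map.empty}" using empty.prems(1) by auto
  then have "F = {} \<or> F = {Map.empty}" by auto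
  moreover have "card B \<ge> 1" using assms(2,3) by (simp add: Suc_leI card_gt_0_iff)
  ultimately show ?case by (auto simp: one_le_power)
next
  case (insert x U)
  let ?Z = "\<lambda>F :: ('a \<rightharpoonup> 'b) set. \<Sum>g\<in>F. w ^ card (dom g)"
  let ?K = "real (card B)"
  define F0 where "F0 = {g\<in>F. g x = None}"
  \<comment> \<open>\<open>Fa a\<close> consists of the members with value \<open>a\<close> at
    \<open>x\<close>, with that value erased. As \<open>F\<close> is down-closed, it lies in
    \<open>F0\<close>, so the sums over all values can be compared with the single family
    \<open>F0\<close>.\<close>
  define Fa where "Fa a = {g. g x = None \<and> g(x \<mapsto> a) \<in> F}" for a
  have finF: "finite F"
    using finite_subset[OF insert.prems(1) finite_partial_functions] insert.hyps(1) assms(2) by simp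
  have finF0: "finite F0" using finF by (simp add: F0_def)
  have dom_fin: "finite (dom g)" if "g \<in> F" for g
    using that insert.prems(1) insert.hyps(1) by (auto intro: finite_subset)
  have FaF0: "Fa a \<subseteq> F0" for a
  proof
    fix g assume "g \<in> Fa a"
    then have "g x = None" "g(x \<mapsto> a) \<in> F" by (auto simp: Fa_def)
    moreover have "g \<subseteq>\<^sub>m g(x \<mapsto> a)" using \<open>g x = None\<close> by (auto simp: map_le_def dom_def)
    ultimately show "g \<in> F0" using insert.prems(2) by (auto simp: F0_def)
  qed
  have finFa: "finite (Fa a)" for a using finF0 FaF0 finite_subset by blast
  have F0sub: "F0 \<subseteq> {g. dom g \<subseteq> U \<and> ran g \<subseteq> B}"
    using insert.prems(1) by (fastforce simp: F0_def dom_def)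
  have F0down: "g' \<in> F0" if "g \<in> F0" "g' \<subseteq>\<^sub>m g" for g g'
    using that insert.prems(2)[of g g'] unfolding F0_def map_le_def by auto (metis domIff)
  have Fadown: "g' \<in> Fa a" if "g \<in> Fa a" "g' \<subseteq>\<^sub>m g" for g g' a
  proof -
    have "g(x \<mapsto> a) \<in> F" "g x = None" using that by (auto simp: Fa_def)
    moreover have "g'(x \<mapsto> a) \<subseteq>\<^sub>m g(x \<mapsto> a)" using that(2) by (auto simp: map_le_def)
    moreover have "g' x = None" using that(2) \<open>g x = None\<close> unfolding map_le_def by (metis domIff)
    ultimately show ?thesis using insert.prems(2) by (auto simp: Fa_def)
  qed
  have split: "F = F0 \<union> (\<Union>a\<in>B. (\<lambda>g. g(x \<mapsto> a)) ` Fa a)"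
  proof (intro equalityI subsetI)
    fix g assume g: "g \<in> F"
    show "g \<in> F0 \<union> (\<Union>a\<in>B. (\<lambda>g. g(x \<mapsto> a)) ` Fa a)"
    proof (cases "g x")
      case None then show ?thesis using g by (simp add: F0_def)
    next
      case (Some a)
      have "g = (g(x := None))(x \<mapsto> a)" using Some by auto
      moreover have "g(x := None) \<in> Fa a" using Some g by (simp add: Fa_def fun_upd_idem)
      moreover have "a \<in> B" using g insert.prems(1) Some by (auto simp: ran_def)
      ultimately show ?thesis by blast
    qed
  qed (auto simp: F0_def Fa_def)
  have "?Z F = ?Z F0 + ?Z (\<Union>a\<in>B. (\<lambda>g. g(x \<mapsto> a)) ` Fa a)"
    by (subst split, rule sum.union_disjoint) (use finF0 finFa assms(2) in \<open>auto simp: F0_def\<close>)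
  also have "?Z (\<Union>a\<in>B. (\<lambda>g. g(x \<mapsto> a)) ` Fa a) = (\<Sum>a\<in>B. ?Z ((\<lambda>g. g(x \<mapsto> a)) ` Fa a))"
  proof (rule sum.UNION_disjoint)
    show "\<forall>a\<in>B. \<forall>b\<in>B. a \<noteq> b \<longrightarrow> (\<lambda>g. g(x \<mapsto> a)) ` Fa a \<inter> (\<lambda>g. g(x \<mapsto> b)) ` Fa b = {}"
    proof (intro ballI impI equals0I)
      fix a b h
      assume "a \<noteq> b" "h \<in> (\<lambda>g. g(x \<mapsto> a)) ` Fa a \<inter> (\<lambda>g. g(x \<mapsto> b)) ` Fa b"
      then have "h x = Some a" "h x = Some b" by (metis (lifting) IntE fun_upd_same imageE)+
      with \<open>a \<noteq> b\<close> show False by simp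
    qed
  qed (use finFa assms(2) in auto)
  also have "\<dots> = (\<Sum>a\<in>B. w * ?Z (Fa a))"
  proof (rule sum.cong[OF refl])
    fix a
    have "inj_on (\<lambda>g. g(x \<mapsto> a)) (Fa a)"
      by (rule inj_on_inverseI[where g = "\<lambda>g. g(x := None)"]) (simp add: Fa_def fun_upd_idem)
    then have "?Z ((\<lambda>g. g(x \<mapsto> a)) ` Fa a) = (\<Sum>g\<in>Fa a. w ^ card (dom (g(x \<mapsto> a))))"
      by (simp add: sum.reindex)
    also have "\<dots> = (\<Sum>g\<in>Fa a. w * w ^ card (dom g))"
    proof (rule sum.cong[OF refl])
      fix g assume g: "g \<in> Fa a"
      then have "x \<notin> dom g" "finite (dom g)"
        using FaF0[of a] dom_fin by (auto simp: Fa_def F0_def)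
      then show "w ^ card (dom (g(x \<mapsto> a))) = w * w ^ card (dom g)" by simp
    qed
    finally show "?Z ((\<lambda>g. g(x \<mapsto> a)) ` Fa a) = w * ?Z (Fa a)" by (simp add: sum_distrib_left)
  qed
  also have "\<dots> = w * (\<Sum>a\<in>B. ?Z (Fa a))" by (simp add: sum_distrib_left)
  finally have Z1: "?Z F = ?Z F0 + w * (\<Sum>a\<in>B. ?Z (Fa a))" .
  define Pr where "Pr = {(a, b). a \<in> B \<and> b \<in> B \<and> a \<noteq> b}"
  have finPr: "finite Pr"
    by (rule finite_subset[of _ "B \<times> B"]) (use assms(2) in \<open>auto simp: Pr_def\<close>)
  have cardPr: "card Pr \<le> card B ^ 2"
    using card_mono[of "B \<times> B" Pr] assms(2)
    by (auto simp: Pr_def card_cartesian_product power2_eq_square)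
  \<comment> \<open>Double counting: \<open>g\<close> in \<open>F0\<close> is counted once for each
    of its \<open>r\<close> possible values, and \<open>r\<close> is at most one plus the number of
    ordered pairs of distinct ones. The one gives back \<open>F0\<close>, the pairs give the
    intersections of \<open>Fa a\<close> and \<open>Fa b\<close>.\<close>
  have "(\<Sum>a\<in>B. ?Z (Fa a)) = (\<Sum>a\<in>B. \<Sum>g\<in>F0. if g \<in> Fa a then w ^ card (dom g) else 0)"
    by (rule sum.cong[OF refl]) (use FaF0 finF0 in \<open>simp add: sum.If_cases Int_absorb1\<close>)
  also have "\<dots> = (\<Sum>g\<in>F0. w ^ card (dom g) * real (card {a\<in>B. g \<in> Fa a}))"
  proof (subst sum.swap, rule sum.cong[OF refl])
    fix g
    have "B \<inter> {a. g \<in> Fa a} = {a\<in>B. g \<in> Fa a}" by auto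
    then show "(\<Sum>a\<in>B. if g \<in> Fa a then w ^ card (dom g) else 0)
        = w ^ card (dom g) * real (card {a\<in>B. g \<in> Fa a})"
      using assms(2) by (simp add: sum.If_cases)
  qed
  also have "\<dots> \<le> (\<Sum>g\<in>F0. w ^ card (dom g) * real (1 + card {(a, b)\<in>Pr. g \<in> Fa a \<inter> Fa b}))"
  proof (intro sum_mono mult_left_mono of_nat_mono)
    fix g
    have "{(a, b)\<in>Pr. g \<in> Fa a \<inter> Fa b}
        = {(a, b). a \<in> {a\<in>B. g \<in> Fa a} \<and> b \<in> {a\<in>B. g \<in> Fa a} \<and> a \<noteq> b}"
      by (auto simp: Pr_def)
    then show "card {a\<in>B. g \<in> Fa a} \<le> 1 + card {(a, b)\<in>Pr. g \<in> Fa a \<inter> Fa b}"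
      using card_le_distinct_pairs[of "{a\<in>B. g \<in> Fa a}"] assms(2) by simp
  qed (use assms(4) in auto)
  also have "\<dots> = ?Z F0
      + (\<Sum>g\<in>F0. \<Sum>ab\<in>Pr. if g \<in> Fa (fst ab) \<inter> Fa (snd ab) then w ^ card (dom g) else 0)"
  proof (simp only: sum.distrib[symmetric], rule sum.cong[OF refl])
    fix g
    have "Pr \<inter> {ab. g \<in> Fa (fst ab) \<inter> Fa (snd ab)} = {(a, b)\<in>Pr. g \<in> Fa a \<inter> Fa b}" by auto
    then show "w ^ card (dom g) * real (1 + card {(a, b)\<in>Pr. g \<in> Fa a \<inter> Fa b}) = w ^ card (dom g)
      + (\<Sum>ab\<in>Pr. if g \<in> Fa (fst ab) \<inter> Fa (snd ab) then w ^ card (dom g) else 0)"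
      using finPr by (simp add: sum.If_cases algebra_simps)
  qed
  also have "(\<Sum>g\<in>F0. \<Sum>ab\<in>Pr. if g \<in> Fa (fst ab) \<inter> Fa (snd ab) then w ^ card (dom g) else 0)
      = (\<Sum>ab\<in>Pr. ?Z (Fa (fst ab) \<inter> Fa (snd ab)))"
  proof (subst sum.swap, rule sum.cong[OF refl])
    fix ab
    have "F0 \<inter> {g. g \<in> Fa (fst ab) \<inter> Fa (snd ab)} = Fa (fst ab) \<inter> Fa (snd ab)"
      using FaF0 by auto
    then show "(\<Sum>g\<in>F0. if g \<in> Fa (fst ab) \<inter> Fa (snd ab) then w ^ card (dom g) else 0)
      = ?Z (Fa (fst ab) \<inter> Fa (snd ab))"
      using finF0 by (simp add: sum.If_cases)
  qed
  finally have Z2: "(\<Sum>a\<in>B. ?Z (Fa a)) \<le> ?Z F0 + (\<Sum>ab\<in>Pr. ?Z (Fa (fst ab) \<inter> Fa (snd ab)))" .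
  let ?W = "(1 + 2 * w) ^ card U"
  have ZF0: "?Z F0 \<le> ?W * ?K ^ (2 * d)"
  proof (rule insert.IH[OF F0sub F0down])
    fix S p q assume "shatters F0 S p q" "S \<subseteq> U" "p ` S \<subseteq> B" "q ` S \<subseteq> B"
    then show "card S \<le> d"
      by (intro insert.prems(3)[of S p q]) (auto simp: shatters_def F0_def)
  qed
  \<comment> \<open>A set shattered by the intersection is still shattered by \<open>F\<close> after
    adding \<open>x\<close> with the colours \<open>a\<close> and \<open>b\<close>. So the dimension
    drops by one and the bound by a factor \<open>card B ^ 2\<close>, which pays for the at most
    \<open>card B ^ 2\<close> pairs.\<close>
  have Zab: "?K ^ 2 * ?Z (Fa (fst ab) \<inter> Fa (snd ab)) \<le> ?W * ?K ^ (2 * d)" if abPr: "ab \<in> Pr" for ab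
  proof -
    obtain a b where ab: "ab = (a, b)" "a \<in> B" "b \<in> B" "a \<noteq> b" using abPr by (auto simp: Pr_def)
    let ?G = "Fa a \<inter> Fa b"
    have shat: "Suc (card S) \<le> d"
      if S: "shatters ?G S p q" "S \<subseteq> U" "p ` S \<subseteq> B" "q ` S \<subseteq> B" for S p q
    proof -
      have xS: "x \<notin> S" using S(2) insert.hyps(2) by auto
      have "card (insert x S) \<le> d"
      proof (rule insert.prems(3))
        show "shatters F (insert x S) (p(x := a)) (q(x := b))" unfolding shatters_def
        proof (intro conjI allI impI)
          show "\<forall>y\<in>insert x S. (p(x := a)) y \<noteq> (q(x := b)) y"
            using S(1) ab xS by (auto simp: shatters_def)
        next
          fix g assume g: "dom g = insert x S"
            "\<forall>y\<in>insert x S. g y = Some ((p(x := a)) y) \<or> g y = Some ((q(x := b)) y)"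
          have "dom (g(x := None)) = S" using g(1) xS by auto
          moreover have "\<forall>y\<in>S. (g(x := None)) y = Some (p y) \<or> (g(x := None)) y = Some (q y)"
            using g(2) xS by auto
          ultimately have "g(x := None) \<in> ?G" using S(1) unfolding shatters_def by blast
          then have "g(x \<mapsto> a) \<in> F" "g(x \<mapsto> b) \<in> F" by (simp_all add: Fa_def)
          moreover have "g x = Some a \<or> g x = Some b" using g(2) by auto
          ultimately show "g \<in> F" by (metis fun_upd_triv)
        qed
      qed (use S ab in auto)
      then show ?thesis using xS S(2) insert.hyps(1) by (simp add: finite_subset)
    qed
    show ?thesis
    proof (cases "?G = {}")
      case True
      then show ?thesis using ab assms(4) by simp
    next
      case False
      then obtain g where "g \<in> ?G" by auto
      \<comment> \<open>A nonempty down-closed family shatters the empty set, so \<open>d\<close> is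
        positive and \<open>d - 1\<close> is a genuine subtraction.\<close>
      then have "Map.empty \<in> ?G"
        using Fadown[of g a Map.empty] Fadown[of g b Map.empty] by simp
      then have "shatters ?G {} (\<lambda>_. a) (\<lambda>_. a)" by (simp add: shatters_def)
      from shat[OF this] have "Suc (card ({} :: 'a set)) \<le> d" by simp
      then have d: "d \<ge> 1" by simp
      have "?Z ?G \<le> ?W * ?K ^ (2 * (d - 1))"
      proof (rule insert.IH)
        show "?G \<subseteq> {g. dom g \<subseteq> U \<and> ran g \<subseteq> B}" using FaF0 F0sub by blast
        show "\<And>g g'. g \<in> ?G \<Longrightarrow> g' \<subseteq>\<^sub>m g \<Longrightarrow> g' \<in> ?G" using Fadown by auto
        show "card S \<le> d - 1"
          if "shatters ?G S p q" "S \<subseteq> U" "p ` S \<subseteq> B" "q ` S \<subseteq> B" for S p q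
          using shat[OF that] by simp
      qed
      then have "?K ^ 2 * ?Z ?G \<le> ?K ^ 2 * (?W * ?K ^ (2 * (d - 1)))"
        by (intro mult_left_mono) auto
      also have "\<dots> = ?W * ?K ^ (2 + 2 * (d - 1))" by (simp only: power_add mult_ac)
      also have "2 + 2 * (d - 1) = 2 * d" using d by simp
      finally show ?thesis using ab by simp
    qed
  qed
  have Kpos: "?K > 0" using assms(2,3) by (simp add: card_gt_0_iff)
  have "(\<Sum>ab\<in>Pr. ?Z (Fa (fst ab) \<inter> Fa (snd ab))) \<le> (\<Sum>ab\<in>Pr. ?W * ?K ^ (2 * d) / ?K ^ 2)"
    by (rule sum_mono) (use Zab Kpos in \<open>simp add: pos_le_divide_eq mult.commute\<close>)
  also have "\<dots> = real (card Pr) * (?W * ?K ^ (2 * d) / ?K ^ 2)" by simp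
  also have "\<dots> \<le> ?K ^ 2 * (?W * ?K ^ (2 * d) / ?K ^ 2)"
  proof (rule mult_right_mono)
    show "real (card Pr) \<le> ?K ^ 2" using cardPr by (metis of_nat_mono of_nat_power)
  qed (use assms(4) in auto)
  also have "\<dots> = ?W * ?K ^ (2 * d)" using Kpos by simp
  finally have Z3: "(\<Sum>ab\<in>Pr. ?Z (Fa (fst ab) \<inter> Fa (snd ab))) \<le> ?W * ?K ^ (2 * d)" .
  \<comment> \<open>The factor \<open>1 + 2 * w\<close>: one from the members undefined at
    \<open>x\<close>, one \<open>w\<close> from the first value at \<open>x\<close>, and another
    from the pairs.\<close>
  have "?Z F \<le> ?Z F0 + w * (?Z F0 + (\<Sum>ab\<in>Pr. ?Z (Fa (fst ab) \<inter> Fa (snd ab))))"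
    unfolding Z1 using Z2 assms(4) by (intro add_left_mono mult_left_mono)
  also have "\<dots> \<le> ?W * ?K ^ (2 * d) + w * (?W * ?K ^ (2 * d) + ?W * ?K ^ (2 * d))"
    using ZF0 Z3 assms(4) by (intro add_mono mult_left_mono)
  also have "\<dots> = (1 + 2 * w) ^ card (insert x U) * ?K ^ (2 * d)"
    using insert.hyps by (simp add: algebra_simps)
  finally show ?case .
qed

section \<open>Families that agree with every total assignment\<close>

lemma card_total_extensions:
  assumes "finite U" "finite B" "dom g \<subseteq> U" "ran g \<subseteq> B"
  shows "card {f \<in> U \<rightarrow>\<^sub>E B. \<forall>x\<in>dom g. g x = Some (f x)} = card B ^ (card U - card (dom g))"
proof -
  have "{f \<in> U \<rightarrow>\<^sub>E B. \<forall>x\<in>dom g. g x = Some (f x)}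
      = (\<Pi>\<^sub>E x\<in>U. if x \<in> dom g then {the (g x)} else B)"
  proof (intro equalityI subsetI)
    fix f assume f: "f \<in> {f \<in> U \<rightarrow>\<^sub>E B. \<forall>x\<in>dom g. g x = Some (f x)}"
    show "f \<in> (\<Pi>\<^sub>E x\<in>U. if x \<in> dom g then {the (g x)} else B)"
    proof (rule PiE_I)
      show "f x \<in> (if x \<in> dom g then {the (g x)} else B)" if "x \<in> U" for x
        using f that PiE_mem[of f U "\<lambda>_. B" x] by simp
    qed (use f PiE_arb in fastforce)
  next
    fix f assume f: "f \<in> (\<Pi>\<^sub>E x\<in>U. if x \<in> dom g then {the (g x)} else B)"
    have val: "f x \<in> (if x \<in> dom g then {the (g x)} else B)" if "x \<in> U" for x
      using PiE_mem[OF f that] .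
    have "f x \<in> B" if "x \<in> U" for x
      using val[OF that] assms(4) by (auto simp: ran_def split: if_splits)
    moreover have "g x = Some (f x)" if "x \<in> dom g" for x
      using val[of x] that assms(3) by auto
    ultimately show "f \<in> {f \<in> U \<rightarrow>\<^sub>E B. \<forall>x\<in>dom g. g x = Some (f x)}"
      using f by (auto simp: PiE_iff)
  qed
  then have "card {f \<in> U \<rightarrow>\<^sub>E B. \<forall>x\<in>dom g. g x = Some (f x)}
      = (\<Prod>x\<in>U. card (if x \<in> dom g then {the (g x)} else B))"
    using assms(1) by (simp add: card_PiE)
  also have "\<dots> = (\<Prod>x\<in>U. if x \<in> dom g then 1 else card B)"
    by (rule prod.cong) auto
  also have "\<dots> = (\<Prod>x\<in>U - dom g. card B)"
    by (rule prod.mono_neutral_cong_right) (use assms(1) in auto)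
  also have "\<dots> = card B ^ (card U - card (dom g))"
    using assms(1,3) by (simp add: card_Diff_subset finite_subset)
  finally show ?thesis .
qed

lemma exp_2_le_9: "exp 2 \<le> (9::real)"
proof -
  have "exp 2 = (exp 1 :: real) ^ 2" by (simp add: exp_of_nat_mult[symmetric])
  also have "\<dots> \<le> (3::real) ^ 2" by (intro power_mono exp_le) auto
  finally show ?thesis by simp
qed

text \<open>A member of size \<open>u\<close> has only \<open>card B ^ (card U - u)\<close> total
  extensions, so at least \<open>card B ^ u\<close> members have that size. Weighted with
  \<open>w = u / card U\<close>, they contribute at least
  \<open>(card B * w) ^ u \<ge> 18 ^ u\<close>, whereas without a large shattered set the total
  weight is at most \<open>exp (2 * u) * card B ^ (2 * d)\<close>, less than
  \<open>9 ^ u * 2 ^ u\<close>.\<close>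

lemma covering_family_shatters:
  fixes F :: "('a \<rightharpoonup> 'b) set"
  assumes U: "finite U" and B: "finite B" "B \<noteq> {}"
    and F: "F \<subseteq> {g. dom g \<subseteq> U \<and> ran g \<subseteq> B}"
    and down: "\<And>g g'. g \<in> F \<Longrightarrow> g' \<subseteq>\<^sub>m g \<Longrightarrow> g' \<in> F"
    and cover: "\<And>f. f \<in> U \<rightarrow>\<^sub>E B \<Longrightarrow> \<exists>g\<in>F. card (dom g) = u \<and> (\<forall>x\<in>dom g. g x = Some (f x))"
    and u: "18 * card U \<le> card B * u" "0 < u"
    and d: "card B ^ (2 * d) < 2 ^ u"
  obtains S p q where "shatters F S p q" "S \<subseteq> U" "p ` S \<subseteq> B" "q ` S \<subseteq> B" "d < card S"
proof (rule ccontr)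
  assume no: "\<not> thesis"
  note thesisI = that
  have dim: "card S \<le> d" if "shatters F S p q" "S \<subseteq> U" "p ` S \<subseteq> B" "q ` S \<subseteq> B" for S p q
    using no thesisI[OF that] by linarith
  define w where "w = real u / real (card U)"
  define Fu where "Fu = {g\<in>F. card (dom g) = u}"
  have finF: "finite F" using finite_subset[OF F finite_partial_functions[OF U B(1)]] .
  then have finFu: "finite Fu" by (simp add: Fu_def)
  obtain f where f: "f \<in> U \<rightarrow>\<^sub>E B" using B by (metis PiE_eq_empty_iff all_not_in_conv)
  obtain g where "g \<in> F" "card (dom g) = u" using cover[OF f] by blast
  then have uU: "u \<le> card U" using F card_mono[OF U, of "dom g"] by blast
  then have cU: "real (card U) > 0" using u(2) by simp
  have wpos: "w > 0" using cU u(2) by (simp add: w_def)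
  have Kpos: "real (card B) > 0" using B by (simp add: card_gt_0_iff)
  have "card B ^ card U = card (U \<rightarrow>\<^sub>E B)" using U by (simp add: card_PiE)
  also have "\<dots> \<le> card (\<Union>g\<in>Fu. {f \<in> U \<rightarrow>\<^sub>E B. \<forall>x\<in>dom g. g x = Some (f x)})"
  proof (rule card_mono)
    show "finite (\<Union>g\<in>Fu. {f \<in> U \<rightarrow>\<^sub>E B. \<forall>x\<in>dom g. g x = Some (f x)})"
      using finFu finite_PiE[OF U, of "\<lambda>_. B"] B by auto
    show "U \<rightarrow>\<^sub>E B \<subseteq> (\<Union>g\<in>Fu. {f \<in> U \<rightarrow>\<^sub>E B. \<forall>x\<in>dom g. g x = Some (f x)})"
      using cover by (auto simp: Fu_def)
  qed
  also have "\<dots> \<le> (\<Sum>g\<in>Fu. card {f \<in> U \<rightarrow>\<^sub>E B. \<forall>x\<in>dom g. g x = Some (f x)})"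
    by (rule card_UN_le[OF finFu])
  also have "\<dots> = (\<Sum>g\<in>Fu. card B ^ (card U - u))"
    by (rule sum.cong[OF refl]) (use card_total_extensions[OF U B(1)] F in \<open>auto simp: Fu_def\<close>)
  finally have "card B ^ card U \<le> card Fu * card B ^ (card U - u)" by simp
  moreover have "card B ^ card U = card B ^ u * card B ^ (card U - u)"
    using uU by (simp add: power_add[symmetric])
  ultimately have "card B ^ u \<le> card Fu" using Kpos by simp
  then have "real (card B) ^ u * w ^ u \<le> real (card Fu) * w ^ u"
    using wpos by (intro mult_right_mono) (auto simp flip: of_nat_power)
  also have "\<dots> = (\<Sum>g\<in>Fu. w ^ card (dom g))" by (simp add: Fu_def)
  also have "\<dots> \<le> (\<Sum>g\<in>F. w ^ card (dom g))"
    by (rule sum_mono2[OF finF]) (use wpos in \<open>auto simp: Fu_def\<close>)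
  also have "\<dots> \<le> (1 + 2 * w) ^ card U * real (card B) ^ (2 * d)"
    using natarajan_weight_bound[OF U B _ F down dim] wpos by simp
  also have "\<dots> \<le> exp (2 * w) ^ card U * real (card B) ^ (2 * d)"
    using wpos by (intro mult_right_mono power_mono) (auto simp: exp_ge_add_one_self)
  also have "exp (2 * w) ^ card U = exp 2 ^ u"
    using cU by (simp add: exp_of_nat_mult[symmetric] w_def)
  also have "exp 2 ^ u * real (card B) ^ (2 * d) < 9 ^ u * 2 ^ u"
  proof (rule mult_le_less_imp_less)
    show "real (card B) ^ (2 * d) < 2 ^ u"
      using d by (metis of_nat_less_iff of_nat_numeral of_nat_power)
  qed (use exp_2_le_9 in \<open>auto intro: power_mono\<close>)
  also have "\<dots> = 18 ^ u" by (simp add: power_mult_distrib[symmetric])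
  also have "\<dots> \<le> (real (card B) * w) ^ u"
  proof (rule power_mono)
    have "real (18 * card U) \<le> real (card B * u)" using u(1) by (rule of_nat_mono)
    then show "18 \<le> real (card B) * w" using cU by (simp add: w_def field_simps)
  qed simp
  finally show False by (simp add: power_mult_distrib)
qed

section \<open>Links between bidders\<close>

text \<open>
  A path of items \<open>I\<close> from bidder \<open>u\<close> to bidder \<open>v\<close>, with first item \<open>x\<close> and last item \<open>y\<close>; the ends of
  an item \<open>t\<close> are \<open>p t\<close> and \<open>q t\<close>. Here \<open>pot j S\<close> is the number of visits of the path to bidder \<open>j\<close> at an
  inner vertex for which \<open>S\<close> contains one of the two path items, and \<open>M\<close> is the number of inner
  vertices. \<open>P\<close> moves every item one step towards \<open>u\<close>, and \<open>Q\<close> towards \<open>v\<close>.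
\<close>

definition link ::
    "nat \<Rightarrow> (nat \<Rightarrow> nat) \<Rightarrow> (nat \<Rightarrow> nat) \<Rightarrow> nat set \<Rightarrow> nat \<Rightarrow> nat \<Rightarrow> (nat \<Rightarrow> nat set \<Rightarrow> nat)
      \<Rightarrow> nat \<Rightarrow> nat \<Rightarrow> nat \<Rightarrow> (nat \<Rightarrow> nat) \<Rightarrow> (nat \<Rightarrow> nat) \<Rightarrow> bool" where
  "link n p q I u v pot M x y P Q \<longleftrightarrow>
     finite I \<and> u < n \<and> v < n \<and> x \<in> I \<and> y \<in> I \<and> M < card I \<and>
     (\<forall>t\<in>I. P t = p t \<or> P t = q t) \<and> (\<forall>t\<in>I. Q t = p t \<or> Q t = q t) \<and>
     (\<forall>j S. pot j S \<le> M) \<and>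
     (\<forall>j S T. S \<subseteq> T \<longrightarrow> pot j S \<le> pot j T) \<and>
     (\<forall>j S T. pot j (S \<union> T) + pot j (S \<inter> T) \<le> pot j S + pot j T) \<and>
     (\<forall>A. disjoint_family_on A {..<n} \<longrightarrow> (\<Sum>j<n. pot j (A j)) \<le> M \<and>
        (\<Sum>j<n. pot j (A j)) + of_bool (x \<in> A u) + of_bool (y \<in> A v) \<le> Suc M) \<and>
     (\<forall>A. (\<forall>t\<in>I. t \<in> A (P t)) \<longrightarrow> M \<le> (\<Sum>j<n. pot j (A j)) \<and> x \<in> A u) \<and>
     (\<forall>A. (\<forall>t\<in>I. t \<in> A (Q t)) \<longrightarrow> M \<le> (\<Sum>j<n. pot j (A j)) \<and> y \<in> A v)"

definition linked :: "nat \<Rightarrow> (nat \<Rightarrow> nat) \<Rightarrow> (nat \<Rightarrow> nat) \<Rightarrow> nat set \<Rightarrow> nat \<Rightarrow> nat \<Rightarrow> bool" where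
  "linked n p q I u v \<longleftrightarrow> (\<exists>pot M x y P Q. link n p q I u v pot M x y P Q)"

text \<open>An edge has no inner vertex, so the potential is zero. Its item is both first and last,
  and disjointness lets at most one end have it.\<close>

lemma linked_single:
  assumes "p e < n" "q e < n" "p e \<noteq> q e"
  shows "linked n p q {e} (p e) (q e)"
proof -
  have "link n p q {e} (p e) (q e) (\<lambda>_ _. 0) 0 e e p q"
    using assms by (auto simp: link_def dest: disjoint_family_onD[of _ _ "p e" "q e"])
  then show ?thesis unfolding linked_def by blast
qed

lemma linked_sym: "linked n p q I u v \<Longrightarrow> linked n p q I v u"
proof -
  have "link n p q I v u pot M y x Q P" if "link n p q I u v pot M x y P Q" for pot M x y P Q
    using that unfolding link_def by (simp add: add_ac)
  then show "linked n p q I u v \<Longrightarrow> linked n p q I v u" unfolding linked_def by blast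
qed

lemma link_facts:
  assumes "link n p q I u v pot M x y P Q"
  shows "finite I" "u < n" "v < n" "x \<in> I" "y \<in> I" "M < card I"
    and "\<forall>t\<in>I. P t = p t \<or> P t = q t" "\<forall>t\<in>I. Q t = p t \<or> Q t = q t"
    and "pot j S \<le> M" "S \<subseteq> T \<Longrightarrow> pot j S \<le> pot j T"
    and "pot j (S \<union> T) + pot j (S \<inter> T) \<le> pot j S + pot j T"
    and "disjoint_family_on A {..<n} \<Longrightarrow> (\<Sum>j<n. pot j (A j)) \<le> M"
    and "disjoint_family_on A {..<n} \<Longrightarrow>
      (\<Sum>j<n. pot j (A j)) + of_bool (x \<in> A u) + of_bool (y \<in> A v) \<le> Suc M"
    and "\<forall>t\<in>I. t \<in> A (P t) \<Longrightarrow> M \<le> (\<Sum>j<n. pot j (A j)) \<and> x \<in> A u"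
    and "\<forall>t\<in>I. t \<in> A (Q t) \<Longrightarrow> M \<le> (\<Sum>j<n. pot j (A j)) \<and> y \<in> A v"
  using assms unfolding link_def by (elim conjE, simp)+

text \<open>The common bidder \<open>w\<close> becomes an inner vertex, with a unit for having the
  last item of the first path or the first item of the second. That unit is at most the sum of the
  two indicators at \<open>w\<close>, so adding the two conflict inequalities gives the new one;
  moving all items towards either end hands \<open>w\<close> one of these two items.\<close>

lemma linked_join:
  assumes "linked n p q I u w" "linked n p q J w v" "I \<inter> J = {}"
  shows "linked n p q (I \<union> J) u v"
proof -
  obtain pot1 M1 x1 y1 P1 Q1 where l1: "link n p q I u w pot1 M1 x1 y1 P1 Q1"
    using assms(1) unfolding linked_def by blast
  obtain pot2 M2 x2 y2 P2 Q2 where l2: "link n p q J w v pot2 M2 x2 y2 P2 Q2"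
    using assms(2) unfolding linked_def by blast
  note 1 = link_facts[OF l1] and 2 = link_facts[OF l2]
  have fin: "finite I" "finite J" and n: "u < n" "v < n" "w < n" using 1(1-3) 2(1-3) by auto
  define r where "r j S = (of_bool (j = w \<and> (y1 \<in> S \<or> x2 \<in> S)) :: nat)" for j S
  define pot where "pot j S = pot1 j S + pot2 j S + r j S" for j S
  define P where "P t = (if t \<in> I then P1 t else P2 t)" for t
  define Q where "Q t = (if t \<in> I then Q1 t else Q2 t)" for t
  have r_sum: "(\<Sum>j<n. r j (A j)) = of_bool (y1 \<in> A w \<or> x2 \<in> A w)" for A
  proof -
    have "(\<Sum>j<n. r j (A j)) = (\<Sum>j<n. if j = w then of_bool (y1 \<in> A w \<or> x2 \<in> A w) else 0)"
      by (rule sum.cong) (auto simp: r_def)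
    then show ?thesis using n by simp
  qed
  have pot_sum: "(\<Sum>j<n. pot j (A j)) = (\<Sum>j<n. pot1 j (A j)) + (\<Sum>j<n. pot2 j (A j))
      + of_bool (y1 \<in> A w \<or> x2 \<in> A w)" for A
    by (simp add: pot_def sum.distrib r_sum)
  have r_submod: "r j (S \<union> T) + r j (S \<inter> T) \<le> r j S + r j T" for j S T
    by (auto simp: r_def)
  have r_mono: "S \<subseteq> T \<Longrightarrow> r j S \<le> r j T" for j S T by (auto simp: r_def)
  have r_le: "r j S \<le> 1" for j S by (simp add: r_def)
  have split: "(\<forall>t\<in>I \<union> J. t \<in> A (if t \<in> I then f t else g t)) \<longleftrightarrow>
      (\<forall>t\<in>I. t \<in> A (f t)) \<and> (\<forall>t\<in>J. t \<in> A (g t))" for A :: "nat \<Rightarrow> nat set" and f g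
    using assms(3) by (auto split: if_splits)
  have "link n p q (I \<union> J) u v pot (Suc (M1 + M2)) x1 y2 P Q" unfolding link_def
  proof (intro conjI allI impI)
    show "Suc (M1 + M2) < card (I \<union> J)"
      using 1(6) 2(6) card_Un_disjoint[OF fin assms(3)] by simp
    show "\<forall>t\<in>I \<union> J. P t = p t \<or> P t = q t" "\<forall>t\<in>I \<union> J. Q t = p t \<or> Q t = q t"
      using 1(7,8) 2(7,8) by (auto simp: P_def Q_def)
    show "pot j S \<le> Suc (M1 + M2)" for j S
      using 1(9)[of j S] 2(9)[of j S] r_le[of j S] by (simp add: pot_def)
    show "pot j S \<le> pot j T" if "S \<subseteq> T" for j S T
      unfolding pot_def by (intro add_mono 1(10) 2(10) r_mono that)
    show "pot j (S \<union> T) + pot j (S \<inter> T) \<le> pot j S + pot j T" for j S T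
      using 1(11)[of j S T] 2(11)[of j S T] r_submod[of j S T] by (simp add: pot_def)
    fix A :: "nat \<Rightarrow> nat set"
    show "(\<Sum>j<n. pot j (A j)) \<le> Suc (M1 + M2)" if "disjoint_family_on A {..<n}"
      using 1(12)[OF that] 2(12)[OF that] by (simp add: pot_sum)
    show "(\<Sum>j<n. pot j (A j)) + of_bool (x1 \<in> A u) + of_bool (y2 \<in> A v) \<le> Suc (Suc (M1 + M2))"
      if "disjoint_family_on A {..<n}"
      using 1(12,13)[OF that] 2(12,13)[OF that] by (auto simp: pot_sum split: if_splits)
    show "Suc (M1 + M2) \<le> (\<Sum>j<n. pot j (A j))" "x1 \<in> A u" if "\<forall>t\<in>I \<union> J. t \<in> A (P t)"
      using 1(14)[of A] 2(14)[of A] that by (simp_all add: pot_sum P_def split)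
    show "Suc (M1 + M2) \<le> (\<Sum>j<n. pot j (A j))" "y2 \<in> A v" if "\<forall>t\<in>I \<union> J. t \<in> A (Q t)"
      using 1(15)[of A] 2(15)[of A] that by (simp_all add: pot_sum Q_def split)
  qed (use fin n 1(4) 2(5) in auto)
  then show ?thesis unfolding linked_def by blast
qed

section \<open>Many disjoint links between two bidders\<close>

lemma linked_nonempty: "linked n p q I u v \<Longrightarrow> I \<noteq> {}"
  by (auto simp: linked_def link_def)

text \<open>In sorted order, equal keys at distance \<open>k\<close> enclose only equal keys, so
  there are at least \<open>k + 1\<close> of them.\<close>

lemma sorted_window_card:
  fixes c :: "'a \<Rightarrow> nat"
  assumes "distinct xs" "sorted (map c xs)" "t + k < length xs" "c (xs ! t) = c (xs ! (t + k))"
  shows "k < card {x \<in> set xs. c x = c (xs ! t)}"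
proof -
  have "(!) xs ` {t..t + k} \<subseteq> {x \<in> set xs. c x = c (xs ! t)}"
  proof
    fix x assume "x \<in> (!) xs ` {t..t + k}"
    then obtain i where i: "x = xs ! i" "t \<le> i" "i \<le> t + k" by auto
    have "c (xs ! t) \<le> c (xs ! i)" "c (xs ! i) \<le> c (xs ! (t + k))"
      using sorted_nth_mono[OF assms(2), of t i] sorted_nth_mono[OF assms(2), of i "t + k"] i
        assms(3) by auto
    then show "x \<in> {x \<in> set xs. c x = c (xs ! t)}" using i assms(3,4) by auto
  qed
  then have "card ((!) xs ` {t..t + k}) \<le> card {x \<in> set xs. c x = c (xs ! t)}"
    by (rule card_mono[rotated]) simp
  moreover have "card ((!) xs ` {t..t + k}) = Suc k"
    using assms(1,3) by (subst card_image) (auto simp: inj_on_def nth_eq_iff_index_eq)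
  ultimately show ?thesis by simp
qed

text \<open>
  Links are the edges of a multigraph on the bidders. A bidder \<open>w\<close> of degree at most \<open>2k\<close> is split
  off: sort the links at \<open>w\<close> by their other end and join the \<open>t\<close>-th with the \<open>(t + k)\<close>-th. If no two
  bidders share more than \<open>k\<close> links, this creates no loops, and only \<open>k\<close> links are lost.
\<close>

lemma bundle_of_links:
  fixes L :: "(nat set \<times> nat \<times> nat) set"
  assumes "finite V" "V \<noteq> {}" "1 \<le> k" "finite L"
    and "\<And>I u v. (I, u, v) \<in> L \<Longrightarrow> linked n p q I u v \<and> u \<in> V \<and> v \<in> V \<and> u \<noteq> v \<and> I \<subseteq> S"
    and "\<And>l l'. l \<in> L \<Longrightarrow> l' \<in> L \<Longrightarrow> l \<noteq> l' \<Longrightarrow> fst l \<inter> fst l' = {}"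
    and "k * (card V - 1) < card L"
  shows "\<exists>u v \<I>. u \<noteq> v \<and> finite \<I> \<and> card \<I> = Suc k \<and> disjoint \<I> \<and>
    (\<forall>I\<in>\<I>. linked n p q I u v \<and> I \<subseteq> S)"
  using assms
proof (induction "card V" arbitrary: V L rule: less_induct)
  case less
  define ends where "ends l = {fst (snd l), snd (snd l)}" for l :: "nat set \<times> nat \<times> nat"
  have linkD: "linked n p q (fst l) (fst (snd l)) (snd (snd l))" "ends l \<subseteq> V"
    "fst (snd l) \<noteq> snd (snd l)" "fst l \<subseteq> S" if "l \<in> L" for l
    using less.prems(5)[of "fst l" "fst (snd l)" "snd (snd l)"] that by (auto simp: ends_def)
  have ne: "fst l \<noteq> {}" if "l \<in> L" for l using linkD(1)[OF that] by (rule linked_nonempty)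
  show ?case
  proof (cases "\<exists>u v. u \<noteq> v \<and> k < card {l\<in>L. ends l = {u, v}}")
    case True
    then obtain u v where uv: "u \<noteq> v" "k < card {l\<in>L. ends l = {u, v}}" by auto
    then obtain K where K: "K \<subseteq> {l\<in>L. ends l = {u, v}}" "card K = Suc k" "finite K"
      by (meson Suc_leI obtain_subset_with_card_n)
    \<comment> \<open>Distinct links have disjoint nonempty item sets, so forgetting the end points
      loses none of the \<open>k + 1\<close> links.\<close>
    have "inj_on fst K"
    proof (rule inj_onI)
      fix l l' assume l: "l \<in> K" "l' \<in> K" "fst l = fst l'"
      then have "l \<in> L" "l' \<in> L" using K(1) by auto
      then show "l = l'" using less.prems(6)[of l l'] l(3) ne[of l] by auto
    qed
    moreover have "disjoint (fst ` K)"
    proof (rule disjointI)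
      fix a b assume "a \<in> fst ` K" "b \<in> fst ` K" "a \<noteq> b"
      moreover from this obtain l l' where "l \<in> K" "l' \<in> K" "a = fst l" "b = fst l'" by blast
      ultimately show "a \<inter> b = {}" using less.prems(6)[of l l'] K(1) by auto
    qed
    moreover have "linked n p q I u v \<and> I \<subseteq> S" if I: "I \<in> fst ` K" for I
    proof -
      obtain l where l: "l \<in> L" "I = fst l" "ends l = {u, v}" using I K(1) by auto
      then have "fst (snd l) = u \<and> snd (snd l) = v \<or> fst (snd l) = v \<and> snd (snd l) = u"
        by (auto simp: ends_def doubleton_eq_iff)
      then show ?thesis using linkD(1,4)[OF l(1)] l(2) linked_sym by auto
    qed
    ultimately show ?thesis using uv(1) K
      by (intro exI[of _ u] exI[of _ v] exI[of _ "fst ` K"]) (auto simp: card_image)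
  next
    case False
    then have few: "card {l\<in>L. ends l = {u, v}} \<le> k" if "u \<noteq> v" for u v
      using that not_less by blast
    \<comment> \<open>Keeping exactly \<open>k * (card V - 1) + 1\<close> links caps the average
      degree at \<open>2 * k\<close>, which provides the bidder to split off.\<close>
    obtain L0 where L0: "L0 \<subseteq> L" "card L0 = Suc (k * (card V - 1))" "finite L0"
      using less.prems(7) by (meson Suc_leI obtain_subset_with_card_n)
    define inc where "inc w = {l\<in>L0. w \<in> ends l}" for w
    have "L0 \<noteq> {}" using L0(2) by auto
    then obtain l where "l \<in> L0" by auto
    then have "card (ends l) \<le> card V" "card (ends l) = 2"
      using linkD(2,3)[of l] L0(1) less.prems(1) by (auto intro!: card_mono simp: ends_def)
    then have V2: "2 \<le> card V" by simp
    have "(\<Sum>w\<in>V. card (inc w)) = (\<Sum>w\<in>V. \<Sum>l\<in>L0. of_bool (w \<in> ends l))"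
      using L0(3) by (simp add: inc_def Int_def)
    also have "\<dots> = (\<Sum>l\<in>L0. \<Sum>w\<in>V. of_bool (w \<in> ends l))" by (rule sum.swap)
    also have "\<dots> = (\<Sum>l\<in>L0. 2)"
    proof (rule sum.cong[OF refl])
      fix l assume "l \<in> L0"
      then have "l \<in> L" using L0(1) by auto
      then have "V \<inter> {w. w \<in> ends l} = ends l" "card (ends l) = 2"
        using linkD(2,3)[of l] by (auto simp: ends_def)
      then show "(\<Sum>w\<in>V. of_bool (w \<in> ends l)) = (2::nat)"
        using less.prems(1) by simp
    qed
    finally have degs: "(\<Sum>w\<in>V. card (inc w)) = 2 * card L0" by simp
    have "\<exists>w\<in>V. card (inc w) \<le> 2 * k"
    proof (rule ccontr)
      assume "\<not> ?thesis"
      then have "(\<Sum>w\<in>V. 2 * k + 1) \<le> (\<Sum>w\<in>V. card (inc w))"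
        by (intro sum_mono) auto
      then have "card V * (2 * k + 1) \<le> 2 * Suc (k * (card V - 1))" using degs L0(2) by simp
      moreover obtain c where "card V = Suc (Suc c)" using V2 by (metis add_2_eq_Suc le_Suc_ex)
      ultimately show False using less.prems(3) by (simp add: algebra_simps)
    qed
    then obtain w where w: "w \<in> V" "card (inc w) \<le> 2 * k" by auto
    define c where "c l = (if fst (snd l) = w then snd (snd l) else fst (snd l))"
      for l :: "nat set \<times> nat \<times> nat"
    have c: "linked n p q (fst l) w (c l)" "ends l = {w, c l}" "c l \<noteq> w" "c l \<in> V" "l \<in> L"
      if "l \<in> inc w" for l
    proof -
      have l: "l \<in> L" "w \<in> ends l" using that L0(1) by (auto simp: inc_def)
      show "linked n p q (fst l) w (c l)" "ends l = {w, c l}" "c l \<noteq> w" "c l \<in> V" "l \<in> L"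
        using linkD[OF l(1)] l linked_sym[OF linkD(1)[OF l(1)]] by (auto simp: c_def ends_def)
    qed
    have fin_inc: "finite (inc w)" using L0(3) by (simp add: inc_def)
    then obtain ys where ys: "set ys = inc w" "distinct ys" using finite_distinct_list by blast
    define xs where "xs = sort_key c ys"
    have xs: "set xs = inc w" "distinct xs" "sorted (map c xs)"
      using ys by (auto simp: xs_def)
    have len: "length xs = card (inc w)" using xs distinct_card by metis
    \<comment> \<open>Truncated subtraction: if \<open>w\<close> has fewer than \<open>k\<close>
      links, then \<open>D = 0\<close> and all of them are dropped. In every case at most
      \<open>k\<close> links are lost, and \<open>D \<le> k\<close> keeps the positions
      \<open>t\<close> and \<open>t + k\<close>, for \<open>t < D\<close>, pairwise
      distinct.\<close>
    define D where "D = length xs - k"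
    have Dk: "D \<le> k" using len w(2) by (simp add: D_def)
    have xsI: "xs ! i \<in> inc w" if "i < length xs" for i
      using nth_mem[OF that] xs(1) by simp
    have xs_disj: "fst (xs ! i) \<inter> fst (xs ! j) = {}"
      if "i < length xs" "j < length xs" "i \<noteq> j" for i j
      using less.prems(6) c(5)[OF xsI] that xs(2) by (metis nth_eq_iff_index_eq)
    have xs_rest: "fst (xs ! i) \<inter> fst l = {}" if "i < length xs" "l \<in> L0 - inc w" for i l
      using less.prems(6)[of "xs ! i" l] xsI[OF that(1)] c(5) that(2) L0(1) by blast
    \<comment> \<open>Equal other ends at distance \<open>k\<close> would yield \<open>k + 1\<close>
      parallel links at \<open>w\<close>, which this case excludes.\<close>
    have xs_ends: "c (xs ! t) \<noteq> c (xs ! (t + k))" if "t < D" for t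
    proof
      assume eq: "c (xs ! t) = c (xs ! (t + k))"
      have t: "t + k < length xs" using that by (simp add: D_def)
      have "k < card {l \<in> inc w. c l = c (xs ! t)}"
        using sorted_window_card[OF xs(2,3) t eq] xs(1) by simp
      also have "\<dots> \<le> card {l\<in>L. ends l = {w, c (xs ! t)}}"
        using c(2,5) less.prems(4) by (intro card_mono) auto
      also have "\<dots> \<le> k" using few c(3)[OF xsI, of t] t by auto
      finally show False by simp
    qed
    define J where "J t = (fst (xs ! t) \<union> fst (xs ! (t + k)), c (xs ! t), c (xs ! (t + k)))" for t
    have tlen: "t < length xs" "t + k < length xs" if "t < D" for t
      using that by (auto simp: D_def)
    have J_disj: "fst (J s) \<inter> fst (J t) = {}" if "s < D" "t < D" "s \<noteq> t" for s t
      using xs_disj[of s t] xs_disj[of s "t + k"] xs_disj[of "s + k" t] xs_disj[of "s + k" "t + k"]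
        tlen[of s] tlen[of t] that Dk by (auto simp: J_def)
    have J_rest: "fst (J t) \<inter> fst l = {}" if "t < D" "l \<in> L0 - inc w" for t l
      using xs_rest[of t l] xs_rest[of "t + k" l] tlen[OF that(1)] that(2) by (auto simp: J_def)
    have J_ne: "fst (J t) \<noteq> {}" if "t < D" for t
      using ne c(5) xsI tlen(1)[OF that] by (auto simp: J_def)
    define L' where "L' = (L0 - inc w) \<union> J ` {..<D}"
    have J_inj: "inj_on J {..<D}"
      using J_disj J_ne by (intro inj_onI) (metis inf.idem lessThan_iff)
    have "(L0 - inc w) \<inter> J ` {..<D} = {}"
      using J_rest J_ne by fastforce
    then have "card L' = card (L0 - inc w) + D"
      using L0(3) J_inj by (simp add: L'_def card_Un_disjoint card_image)
    also have "card (L0 - inc w) = card L0 - length xs"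
      using fin_inc len by (subst card_Diff_subset) (auto simp: inc_def)
    finally have cardL': "card L0 \<le> card L' + k" by (simp add: D_def)
    have V': "card (V - {w}) = card V - 1" using w(1) less.prems(1) by simp
    show ?thesis
    proof (rule less.hyps[of "V - {w}" L'])
      show "card (V - {w}) < card V" using V' V2 by simp
      have "card (V - {w}) \<noteq> 0" using V' V2 by simp
      then show "V - {w} \<noteq> {}" by (metis card.empty)
      show "linked n p q I u v \<and> u \<in> V - {w} \<and> v \<in> V - {w} \<and> u \<noteq> v \<and> I \<subseteq> S"
        if new: "(I, u, v) \<in> L'" for I u v
      proof (cases "(I, u, v) \<in> L0 - inc w")
        case True
        then have "(I, u, v) \<in> L" using L0(1) by auto
        then show ?thesis using less.prems(5) True by (auto simp: inc_def ends_def)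
      next
        case False
        then obtain t where t: "t < D" "(I, u, v) = J t"
          using new by (auto simp: L'_def)
        note x1 = xsI[OF tlen(1)[OF t(1)]] and x2 = xsI[OF tlen(2)[OF t(1)]]
        have "linked n p q (fst (xs ! t) \<union> fst (xs ! (t + k))) (c (xs ! t)) (c (xs ! (t + k)))"
        proof (rule linked_join[OF linked_sym[OF c(1)[OF x1]] c(1)[OF x2]])
          show "fst (xs ! t) \<inter> fst (xs ! (t + k)) = {}"
            using tlen[OF t(1)] less.prems(3) by (intro xs_disj) auto
        qed
        then show ?thesis
          using t c(3,4)[OF x1] c(3,4)[OF x2] xs_ends[OF t(1)] linkD(4)[OF c(5)[OF x1]]
            linkD(4)[OF c(5)[OF x2]] by (auto simp: J_def)
      qed
      show "fst l \<inter> fst l' = {}" if l: "l \<in> L'" "l' \<in> L'" "l \<noteq> l'" for l l'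
      proof -
        consider "l \<in> L0 - inc w" "l' \<in> L0 - inc w"
          | t where "l \<in> L0 - inc w" "t < D" "l' = J t"
          | t where "t < D" "l = J t" "l' \<in> L0 - inc w"
          | s t where "s < D" "l = J s" "t < D" "l' = J t"
          using l(1,2) by (auto simp: L'_def)
        then show ?thesis
        proof cases
          case 1
          then show ?thesis using less.prems(6) l(3) L0(1) by blast
        next
          case 2
          then show ?thesis using J_rest by blast
        next
          case 3
          then show ?thesis using J_rest by blast
        next
          case 4
          then show ?thesis using J_disj l(3) by blast
        qed
      qed
      \<comment> \<open>One bidder and at most \<open>k\<close> links fewer, so the density
        condition survives.\<close>
      have "Suc (k * (card V - 1)) \<le> card L' + k" using cardL' L0(2) by simp
      moreover have "k * (card V - 1) = k * (card V - 1 - 1) + k"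
      proof -
        have "card V - 1 = Suc (card V - 1 - 1)" using V2 by simp
        then show ?thesis by (metis mult_Suc_right add.commute)
      qed
      ultimately show "k * (card (V - {w}) - 1) < card L'" using V' by simp
    qed (use less.prems(1,3) L0(3) in \<open>auto simp: L'_def inc_def\<close>)
  qed
qed

section \<open>The hard valuations\<close>

text \<open>Twice the rank function of the uniform matroid of rank \<open>h\<close>, lowered by one
  on the \<open>h\<close>-sets outside \<open>\<X>\<close>. Doubling makes that unit small enough to
  preserve monotonicity and submodularity.\<close>

definition peak :: "nat \<Rightarrow> 'c set set \<Rightarrow> 'c set \<Rightarrow> nat" where
  "peak h \<X> Z = (if card Z = h \<and> Z \<notin> \<X> then 2 * h - 1 else min (2 * card Z) (2 * h))"

lemma peak_le: "peak h \<X> Z \<le> 2 * h" "peak h \<X> Z \<le> 2 * card Z"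
  by (auto simp: peak_def)

lemma peak_ge: "h \<le> card Z \<Longrightarrow> 2 * h - 1 \<le> peak h \<X> Z"
  by (auto simp: peak_def)

lemma peak_in: "Z \<in> \<X> \<Longrightarrow> card Z = h \<Longrightarrow> peak h \<X> Z = 2 * h"
  by (auto simp: peak_def)

lemma peak_notin: "Z \<notin> \<X> \<Longrightarrow> card Z = h \<Longrightarrow> peak h \<X> Z = 2 * h - 1"
  by (auto simp: peak_def)

lemma peak_mono:
  assumes "finite T" "S \<subseteq> T"
  shows "peak h \<X> S \<le> peak h \<X> T"
proof (cases "S = T")
  case False
  then have "card S < card T" using assms by (metis psubsetI psubset_card_mono)
  then show ?thesis by (auto simp: peak_def)
qed simp

text \<open>For incomparable sets the intersection is strictly smaller than both. If it has at least
  \<open>h\<close> elements, both sets have the full value \<open>2 * h\<close>. Otherwise its value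
  is at most \<open>2 * h - 2\<close> and undiminished, and this slack covers the loss of one unit
  each at \<open>S\<close> and \<open>T\<close>.\<close>

lemma peak_submodular:
  assumes "finite S" "finite T"
  shows "peak h \<X> (S \<union> T) + peak h \<X> (S \<inter> T) \<le> peak h \<X> S + peak h \<X> T"
proof (cases "S \<subseteq> T \<or> T \<subseteq> S")
  case True
  then show ?thesis by (auto simp: Un_absorb1 Un_absorb2 Int_absorb1 Int_absorb2)
next
  case False
  let ?i = "card (S \<inter> T)"
  have less: "?i < card S" "?i < card T" using False assms
    by (auto intro!: psubset_card_mono)
  have un: "card (S \<union> T) + ?i = card S + card T" using card_Un_Int[OF assms] by simp
  show ?thesis
  proof (cases "h \<le> ?i")
    case True
    then have "2 * h \<le> peak h \<X> S" "2 * h \<le> peak h \<X> T" using less by (auto simp: peak_def)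
    then show ?thesis using peak_le(1)[of h \<X> "S \<union> T"] peak_le(1)[of h \<X> "S \<inter> T"] by simp
  next
    case False
    then have I: "peak h \<X> (S \<inter> T) = 2 * ?i" by (auto simp: peak_def)
    have U: "peak h \<X> (S \<union> T) \<le> 2 * h" "peak h \<X> (S \<union> T) \<le> 2 * card (S \<union> T)"
      using peak_le by auto
    have S: "peak h \<X> S \<ge> (if card S < h then 2 * card S else 2 * h - 1)"
      and T: "peak h \<X> T \<ge> (if card T < h then 2 * card T else 2 * h - 1)"
      by (auto simp: peak_def)
    show ?thesis using I U S T less un False by (auto split: if_splits)
  qed
qed

section \<open>From links to communication\<close>

lemma finite_allocations: "finite (allocations n m)"
proof -
  have "allocations n m \<subseteq> {..<n} \<rightarrow>\<^sub>E Pow {..<m}" by (auto simp: allocations_def)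
  then show ?thesis by (rule finite_subset) (auto intro: finite_PiE)
qed

lemma MIR_ge: "\<A> \<subseteq> allocations n m \<Longrightarrow> A \<in> \<A> \<Longrightarrow> welfare n w A \<le> MIR n \<A> w"
  unfolding MIR_def by (intro Max_ge) (auto intro: finite_subset[OF _ finite_allocations])

lemma two_power_le_central_binomial:
  assumes "1 \<le> h"
  shows "2 ^ h \<le> (2 * h) choose h"
proof -
  have "2 ^ h \<le> real ((2 * h) choose h)"
    using binomial_ge_n_over_k_pow_k[of h "2 * h", where ?'a = real] assms by simp
  then have "real (2 ^ h) \<le> real ((2 * h) choose h)" by simp
  then show ?thesis by (simp only: of_nat_le_iff)
qed

lemma double_le_power2: "2 \<le> m \<Longrightarrow> 2 * m \<le> 2 ^ m" for m :: nat
proof -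
  assume "2 \<le> m"
  then obtain r where r: "m = Suc r" by (cases m) auto
  have "Suc r \<le> 2 ^ r" by (rule Suc_leI[OF less_exp])
  then show ?thesis unfolding r by simp
qed

text \<open>
  A fooling set: bidder \<open>u\<close> holds a family of \<open>h\<close>-sets of links, bidder \<open>v\<close> the complements of the
  \<open>h\<close>-sets outside that family, and every other bidder only has to keep the links intact. If two
  families shared a transcript, then the allocation that is optimal for one crossed profile would
  lose one unit on the other.
\<close>

lemma linked_pair_communication:
  fixes \<I> :: "nat set set"
  assumes I: "finite \<I>" "card \<I> = 2 * h" "disjoint \<I>"
    and links: "\<And>I. I \<in> \<I> \<Longrightarrow> linked n p q I u v \<and> I \<subseteq> {..<m}"
    and uv: "u \<noteq> v" and h: "1 \<le> h"
    and D: "real ` {0..2 ^ m} \<subseteq> D"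
    and bank: "\<A> \<subseteq> allocations n m"
    and shat: "\<And>a. (\<And>t. t \<in> \<Union>\<I> \<Longrightarrow> a t = p t \<or> a t = q t) \<Longrightarrow> \<exists>A\<in>\<A>. \<forall>t\<in>\<Union>\<I>. t \<in> A (a t)"
    and mech: "\<And>w. w \<in> submod_profiles D n m \<Longrightarrow> f w \<in> \<A> \<and> welfare n w (f w) = MIR n \<A> w"
    and prot: "\<And>w. w \<in> submod_profiles D n m \<Longrightarrow> run \<tau> w = f w"
  shows "(2 * h) choose h \<le> bits \<tau>"
proof (rule ccontr)
  assume bits: "\<not> (2 * h) choose h \<le> bits \<tau>"
  have "\<forall>I. \<exists>d. I \<in> \<I> \<longrightarrow> (case d of (pot, M, x, y, P, Q) \<Rightarrow> link n p q I u v pot M x y P Q)"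
    using links by (auto simp: linked_def)
  then obtain d where d: "\<And>I. I \<in> \<I> \<Longrightarrow>
      (case d I of (pot, M, x, y, P, Q) \<Rightarrow> link n p q I u v pot M x y P Q)"
    by metis
  define pot where "pot I = fst (d I)" for I
  define M where "M I = fst (snd (d I))" for I
  define x where "x I = fst (snd (snd (d I)))" for I
  define y where "y I = fst (snd (snd (snd (d I))))" for I
  define P where "P I = fst (snd (snd (snd (snd (d I)))))" for I
  define Q where "Q I = snd (snd (snd (snd (snd (d I)))))" for I
  have link: "link n p q I u v (pot I) (M I) (x I) (y I) (P I) (Q I)" if "I \<in> \<I>" for I
    using d[OF that] by (simp add: pot_def M_def x_def y_def P_def Q_def split: prod.splits)
  have "\<I> \<noteq> {}" using I(2) h by auto
  then obtain I0 where "I0 \<in> \<I>" by auto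
  then have un: "u < n" "v < n" using link_facts(2,3)[OF link] by auto
  define H where "H = {X. X \<subseteq> \<I> \<and> card X = h}"
  have cardH: "card H = (2 * h) choose h" and finH: "finite H"
    using n_subsets[OF I(1)] I(1,2) by (auto simp: H_def)
  define \<mu> where "\<mu> = (\<Sum>I\<in>\<I>. M I)"
  \<comment> \<open>A link has more items than inner vertices, which leaves room for one more unit
    per link. All values are then integers of size at most \<open>2 * m\<close>, within the
    precision \<open>2 ^ m\<close> that \<open>D\<close> guarantees.\<close>
  have mu: "\<mu> + 2 * h \<le> m"
  proof -
    have "\<mu> + 2 * h = (\<Sum>I\<in>\<I>. M I + 1)" 
      by (simp only: \<mu>_def sum.distrib sum_constant I(2) of_nat_id mult_1_right)
    also have "\<dots> \<le> (\<Sum>I\<in>\<I>. card I)"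
      using link_facts(6)[OF link] by (intro sum_mono) (simp add: Suc_le_eq)
    also have "\<dots> = card (\<Union>\<I>)"
      using I(3) link_facts(1)[OF link]
      by (intro card_Union_disjoint[symmetric]) (auto simp: pairwise_def disjoint_def disjnt_def)
    also have "\<dots> \<le> card {..<m}" using links by (intro card_mono) auto
    finally show ?thesis by simp
  qed
  define X where "X S = {I\<in>\<I>. x I \<in> S}" for S
  define Y where "Y S = {I\<in>\<I>. y I \<in> S}" for S
  have finXY: "finite (X S)" "finite (Y S)" for S using I(1) by (auto simp: X_def Y_def)
  have XY_mono: "S \<subseteq> T \<Longrightarrow> X S \<subseteq> X T" "S \<subseteq> T \<Longrightarrow> Y S \<subseteq> Y T" for S T
    by (auto simp: X_def Y_def)
  have XY_lat: "X (S \<union> T) = X S \<union> X T" "X (S \<inter> T) = X S \<inter> X T"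
    "Y (S \<union> T) = Y S \<union> Y T" "Y (S \<inter> T) = Y S \<inter> Y T" for S T
    by (auto simp: X_def Y_def)
  define pu where "pu \<X> j S = (if j = u then peak h \<X> (X S) else 0)" for \<X> j S
  define pv where "pv \<Y> j S = (if j = v then peak h \<Y> (Y S) else 0)" for \<Y> j S
  define val where "val \<X> \<Y> j S = 2 * (\<Sum>I\<in>\<I>. pot I j S) + pu \<X> j S + pv \<Y> j S" for \<X> \<Y> j S
  define prof where "prof \<X> \<Y> = (\<lambda>j\<in>{..<n}. \<lambda>S\<in>Pow {..<m}. real (val \<X> \<Y> j S))" for \<X> \<Y>
  have val_mono: "val \<X> \<Y> j S \<le> val \<X> \<Y> j T" if "S \<subseteq> T" for \<X> \<Y> j S T
    unfolding val_def pu_def pv_def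
    using link_facts(10)[OF link that] peak_mono[OF finXY(1) XY_mono(1)[OF that]]
      peak_mono[OF finXY(2) XY_mono(2)[OF that]]
    by (intro add_mono mult_left_mono sum_mono) auto
  have val_submod: "val \<X> \<Y> j (S \<union> T) + val \<X> \<Y> j (S \<inter> T) \<le> val \<X> \<Y> j S + val \<X> \<Y> j T"
    for \<X> \<Y> j S T
  proof -
    have "(\<Sum>I\<in>\<I>. pot I j (S \<union> T)) + (\<Sum>I\<in>\<I>. pot I j (S \<inter> T))
        \<le> (\<Sum>I\<in>\<I>. pot I j S) + (\<Sum>I\<in>\<I>. pot I j T)"
      unfolding sum.distrib[symmetric] using link_facts(11)[OF link] by (intro sum_mono)
    moreover have "pu \<X> j (S \<union> T) + pu \<X> j (S \<inter> T) \<le> pu \<X> j S + pu \<X> j T"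
      using peak_submodular[OF finXY(1) finXY(1)] by (simp add: pu_def XY_lat)
    moreover have "pv \<Y> j (S \<union> T) + pv \<Y> j (S \<inter> T) \<le> pv \<Y> j S + pv \<Y> j T"
      using peak_submodular[OF finXY(2) finXY(2)] by (simp add: pv_def XY_lat)
    ultimately show ?thesis unfolding val_def by linarith
  qed
  have val_le: "val \<X> \<Y> j S \<le> 2 ^ m" for \<X> \<Y> j S
  proof -
    have "(\<Sum>I\<in>\<I>. pot I j S) \<le> \<mu>"
      unfolding \<mu>_def using link_facts(9)[OF link] by (intro sum_mono)
    moreover have "pu \<X> j S \<le> 2 * h" "pv \<Y> j S \<le> 2 * h"
      using peak_le(1) by (auto simp: pu_def pv_def)
    ultimately have "val \<X> \<Y> j S \<le> 2 * m" unfolding val_def using mu by linarith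
    also have "2 * m \<le> 2 ^ m" using mu h by (intro double_le_power2) simp
    finally show ?thesis .
  qed
  have prof_in: "prof \<X> \<Y> \<in> submod_profiles D n m" for \<X> \<Y>
  proof -
    have "(\<lambda>S\<in>Pow {..<m}. real (val \<X> \<Y> j S)) \<in> submod_valuations D m" for j
    proof -
      have "real (val \<X> \<Y> j S) \<in> D" for S using D val_le by auto
      moreover have "real (val \<X> \<Y> j (S \<union> T)) + real (val \<X> \<Y> j (S \<inter> T))
          \<le> real (val \<X> \<Y> j S) + real (val \<X> \<Y> j T)" for S T
        using val_submod[of \<X> \<Y> j S T] by linarith
      moreover have "real (val \<X> \<Y> j (S \<inter> T)) = real (val \<X> \<Y> j (T \<inter> S))" for S T
        by (simp add: Int_commute)
      ultimately show ?thesis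
        using val_mono by (auto simp: submod_valuations_def mono_on_def submodular_on_def le_infI1)
    qed
    then show ?thesis by (auto simp: submod_profiles_def prof_def)
  qed
  define pots where "pots A = (\<Sum>I\<in>\<I>. \<Sum>j<n. pot I j (A j))" for A :: allocation
  have prof_welfare: "welfare n (prof \<X> \<Y>) A
      = real (2 * pots A + peak h \<X> (X (A u)) + peak h \<Y> (Y (A v)))"
    if A: "A \<in> \<A>" for \<X> \<Y> A
  proof -
    have "A j \<subseteq> {..<m}" if "j < n" for j
      using A bank that by (auto simp: allocations_def PiE_iff)
    then have "welfare n (prof \<X> \<Y>) A = (\<Sum>j<n. real (val \<X> \<Y> j (A j)))"
      unfolding welfare_def by (intro sum.cong) (auto simp: prof_def)
    also have "\<dots> = real (2 * (\<Sum>j<n. \<Sum>I\<in>\<I>. pot I j (A j)) + (\<Sum>j<n. pu \<X> j (A j))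
        + (\<Sum>j<n. pv \<Y> j (A j)))"
      unfolding val_def of_nat_sum[symmetric] by (simp only: sum.distrib sum_distrib_left)
    also have "(\<Sum>j<n. pu \<X> j (A j)) = (\<Sum>j<n. if j = u then peak h \<X> (X (A u)) else 0)"
      by (rule sum.cong) (auto simp: pu_def)
    also have "(\<Sum>j<n. pv \<Y> j (A j)) = (\<Sum>j<n. if j = v then peak h \<Y> (Y (A v)) else 0)"
      by (rule sum.cong) (auto simp: pv_def)
    also have "(\<Sum>j<n. \<Sum>I\<in>\<I>. pot I j (A j)) = pots A" unfolding pots_def by (rule sum.swap)
    finally show ?thesis using un by simp
  qed
  \<comment> \<open>A link that delivers its end items to \<open>u\<close> and \<open>v\<close> at
    once lacks a unit of potential.\<close>
  have pots_le: "pots A + card (X (A u) \<inter> Y (A v)) \<le> \<mu>" if "A \<in> \<A>" for A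
  proof -
    have disj: "disjoint_family_on A {..<n}" using that bank by (auto simp: allocations_def)
    have "pots A + card (X (A u) \<inter> Y (A v))
        = (\<Sum>I\<in>\<I>. (\<Sum>j<n. pot I j (A j)) + of_bool (x I \<in> A u \<and> y I \<in> A v))"
    proof -
      have "\<I> \<inter> {I. x I \<in> A u \<and> y I \<in> A v} = X (A u) \<inter> Y (A v)" by (auto simp: X_def Y_def)
      then show ?thesis using I(1) by (simp add: pots_def sum.distrib)
    qed
    also have "\<dots> \<le> \<mu>" unfolding \<mu>_def
    proof (rule sum_mono)
      fix I assume "I \<in> \<I>"
      from link_facts(12,13)[OF link[OF this] disj]
      show "(\<Sum>j<n. pot I j (A j)) + of_bool (x I \<in> A u \<and> y I \<in> A v) \<le> M I"
        by (cases "x I \<in> A u \<and> y I \<in> A v") auto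
    qed
    finally show ?thesis .
  qed
  have attained: "2 * \<mu> + peak h \<X> Z + peak h \<Y> (\<I> - Z) \<le> MIR n \<A> (prof \<X> \<Y>)"
    if Z: "Z \<subseteq> \<I>" for Z \<X> \<Y>
  proof -
    \<comment> \<open>\<open>c t\<close> is the link through the item \<open>t\<close>. The links in
      \<open>Z\<close> are moved towards \<open>u\<close>, the others towards \<open>v\<close>;
      shattering supplies an allocation of the bank that does so.\<close>
    define c where "c t = (THE I. I \<in> \<I> \<and> t \<in> I)" for t
    have c: "c t = I" if "I \<in> \<I>" "t \<in> I" for I t
      unfolding c_def using that I(3) by (intro the_equality) (auto simp: disjoint_def)
    define a where "a t = (if c t \<in> Z then P (c t) t else Q (c t) t)" for t
    have "a t = p t \<or> a t = q t" if t: "t \<in> \<Union>\<I>" for t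
    proof -
      obtain I where I: "I \<in> \<I>" "t \<in> I" using t by auto
      then show ?thesis using link_facts(7,8)[OF link[OF I(1)]] c[OF I] by (simp add: a_def)
    qed
    then obtain A where A: "A \<in> \<A>" "\<forall>t\<in>\<Union>\<I>. t \<in> A (a t)" using shat by blast
    have inZ: "M I \<le> (\<Sum>j<n. pot I j (A j)) \<and> x I \<in> A u" if "I \<in> Z" for I
    proof (rule link_facts(14)[OF link])
      show "I \<in> \<I>" using that Z by auto
      show "\<forall>t\<in>I. t \<in> A (P I t)"
      proof
        fix t assume "t \<in> I"
        then show "t \<in> A (P I t)"
          using A(2) c[of I t] that \<open>I \<in> \<I>\<close> by (auto simp: a_def split: if_splits)
      qed
    qed
    have notZ: "M I \<le> (\<Sum>j<n. pot I j (A j)) \<and> y I \<in> A v" if "I \<in> \<I> - Z" for I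
    proof (rule link_facts(15)[OF link])
      show "I \<in> \<I>" using that by auto
      show "\<forall>t\<in>I. t \<in> A (Q I t)"
      proof
        fix t assume "t \<in> I"
        then show "t \<in> A (Q I t)"
          using A(2) c[of I t] that by (auto simp: a_def split: if_splits)
      qed
    qed
    have "\<mu> \<le> pots A" unfolding \<mu>_def pots_def using inZ notZ by (intro sum_mono) blast
    moreover have "peak h \<X> Z \<le> peak h \<X> (X (A u))"
      using inZ Z by (intro peak_mono finXY) (auto simp: X_def)
    moreover have "peak h \<Y> (\<I> - Z) \<le> peak h \<Y> (Y (A v))"
      using notZ by (intro peak_mono finXY) (auto simp: Y_def)
    ultimately have "2 * \<mu> + peak h \<X> Z + peak h \<Y> (\<I> - Z) \<le> welfare n (prof \<X> \<Y>) A"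
      unfolding prof_welfare[OF A(1)] of_nat_le_iff by linarith
    also have "\<dots> \<le> MIR n \<A> (prof \<X> \<Y>)" by (rule MIR_ge[OF bank A(1)])
    finally show ?thesis .
  qed
  \<comment> \<open>For \<open>Z \<in> H\<close>, exactly one of \<open>Z \<in> \<X>\<close> and
    \<open>\<I> - Z \<in> co \<X>\<close> holds. So no balanced division reaches both peaks for
    \<open>\<X>\<close> against \<open>co \<X>\<close>, but \<open>Z \<in> \<X> - \<X>'\<close> does
    so for \<open>\<X>\<close> against \<open>co \<X>'\<close>.\<close>
  define co where "co \<X> = {Z\<in>H. \<I> - Z \<notin> \<X>}" for \<X>
  have Hc: "Z \<subseteq> \<I>" "card Z = h" "\<I> - Z \<in> H" "\<I> - (\<I> - Z) = Z" if "Z \<in> H" for Z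
  proof -
    show Z: "Z \<subseteq> \<I>" "card Z = h" using that by (auto simp: H_def)
    then show "\<I> - (\<I> - Z) = Z" by auto
    show "\<I> - Z \<in> H" using Z I(1,2) by (auto simp: H_def card_Diff_subset finite_subset)
  qed
  have collide: False
    if XX: "\<X> \<subseteq> H" "\<X>' \<subseteq> H" "\<X>' \<noteq> {}" "Z \<in> \<X>" "Z \<notin> \<X>'"
      and tr: "transcript \<tau> (prof \<X> (co \<X>)) = transcript \<tau> (prof \<X>' (co \<X>'))" for \<X> \<X>' Z
  proof -
    \<comment> \<open>\<open>\<X>\<close> affects the valuation of \<open>u\<close> only and
      \<open>\<Y>\<close> that of \<open>v\<close> only, so each coordinate of a crossed profile
      comes from one of the two colliding profiles.\<close>
    have indep: "prof \<X>\<^sub>1 \<Y>\<^sub>1 i = prof \<X>\<^sub>1 \<Y>\<^sub>2 i \<or> prof \<X>\<^sub>1 \<Y>\<^sub>1 i = prof \<X>\<^sub>2 \<Y>\<^sub>1 i" for \<X>\<^sub>1 \<X>\<^sub>2 \<Y>\<^sub>1 \<Y>\<^sub>2 i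
      using uv by (cases "i = v") (auto simp: prof_def val_def pu_def pv_def restrict_def)
    let ?w = "prof \<X> (co \<X>')" and ?w' = "prof \<X>' (co \<X>)"
    have "run \<tau> ?w = run \<tau> (prof \<X> (co \<X>))"
      using transcript_rectangle[OF tr, of ?w] indep by blast
    moreover have "run \<tau> ?w' = run \<tau> (prof \<X> (co \<X>))"
      using transcript_rectangle[OF tr, of ?w'] indep by blast
    ultimately have fw: "f ?w' = f ?w" using prot prof_in by metis
    define A where "A = f ?w"
    have A: "A \<in> \<A>" "welfare n ?w A = MIR n \<A> ?w" "welfare n ?w' A = MIR n \<A> ?w'"
      using mech[OF prof_in, of \<X> "co \<X>'"] mech[OF prof_in, of \<X>' "co \<X>"] fw by (auto simp: A_def)
    let ?S = "X (A u)" and ?T = "Y (A v)"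
    have Z: "Z \<in> H" using XX by auto
    have "\<I> - Z \<in> co \<X>'" using Hc[OF Z] XX(5) by (simp add: co_def)
    \<comment> \<open>This crossed profile attains the largest conceivable value. So
      \<open>A\<close> loses no potential and divides the links into complementary
      \<open>h\<close>-sets, the part of \<open>u\<close> being in \<open>\<X>\<close> and not in
      \<open>\<X>'\<close>.\<close>
    then have "real (2 * \<mu> + 2 * h + 2 * h) \<le> welfare n ?w A"
      using attained[OF Hc(1)[OF Z], of \<X> "co \<X>'"] A(2) peak_in[OF XX(4) Hc(2)[OF Z]]
        peak_in[of "\<I> - Z" "co \<X>'" h] Hc(2)[OF Hc(3)[OF Z]] by simp
    then have full: "2 * \<mu> + 2 * h + 2 * h \<le> 2 * pots A + peak h \<X> ?S + peak h (co \<X>') ?T"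
      unfolding prof_welfare[OF A(1)] of_nat_le_iff .
    have ST: "pots A + card (?S \<inter> ?T) \<le> \<mu>" by (rule pots_le[OF A(1)])
    have le: "peak h \<X> ?S \<le> 2 * h" "peak h (co \<X>') ?T \<le> 2 * h" by (rule peak_le)+
    have pS: "peak h \<X> ?S = 2 * h" and pT: "peak h (co \<X>') ?T = 2 * h"
      and "card (?S \<inter> ?T) = 0"
      using full ST le by linarith+
    then have disj: "?S \<inter> ?T = {}" using finXY by simp
    have "h \<le> card ?S" "h \<le> card ?T"
      using pS pT peak_le(2)[of h \<X> ?S] peak_le(2)[of h "co \<X>'" ?T] by linarith+
    moreover have sub: "?S \<subseteq> \<I>" "?T \<subseteq> \<I>" by (auto simp: X_def Y_def)
    moreover have "card ?S + card ?T = card (?S \<union> ?T)"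
      using card_Un_disjoint[OF finXY disj] by simp
    moreover have "card (?S \<union> ?T) \<le> 2 * h" using card_mono[OF I(1), of "?S \<union> ?T"] sub I(2) by simp
    ultimately have cS: "card ?S = h" "card ?T = h" "card (?S \<union> ?T) = card \<I>"
      using I(2) by linarith+
    have "?S \<union> ?T = \<I>" using card_subset_eq[OF I(1) _ cS(3)] sub by auto
    then have T: "?T = \<I> - ?S" using disj by auto
    have "?S \<in> \<X>" using pS peak_notin[of ?S \<X> h] cS(1) h by fastforce
    moreover have "?T \<in> co \<X>'" using pT peak_notin[of ?T "co \<X>'" h] cS(2) h by fastforce
    ultimately have "?S \<notin> \<X>'" "?T \<notin> co \<X>"
      using sub T by (auto simp: co_def double_diff)
    then have "2 * pots A + peak h \<X>' ?S + peak h (co \<X>) ?T \<le> 2 * \<mu> + (2 * h - 1) + (2 * h - 1)"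
      using ST cS by (simp add: peak_notin)
    then have up: "welfare n ?w' A \<le> real (2 * \<mu> + (2 * h - 1) + (2 * h - 1))"
      unfolding prof_welfare[OF A(1)] of_nat_le_iff .
    \<comment> \<open>On the opposite crossed profile \<open>A\<close> misses both peaks by one. A
      division at any \<open>Z' \<in> \<X>'\<close> misses at most one of them and beats
      \<open>A\<close>, although \<open>f\<close> chooses \<open>A\<close> there too; hence the
      families have to be nonempty.\<close>
    obtain Z' where Z': "Z' \<in> \<X>'" "Z' \<in> H" using XX(2,3) by auto
    have "real (2 * \<mu> + 2 * h + (2 * h - 1)) \<le> real (2 * \<mu> + peak h \<X>' Z' + peak h (co \<X>) (\<I> - Z'))"
      using peak_in[OF Z'(1) Hc(2)[OF Z'(2)]] peak_ge[of h "\<I> - Z'" "co \<X>"]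
        Hc(2)[OF Hc(3)[OF Z'(2)]] unfolding of_nat_le_iff by linarith
    also have "\<dots> \<le> welfare n ?w' A"
      using attained[OF Hc(1)[OF Z'(2)], of \<X>' "co \<X>"] A(3) by simp
    finally have "real (2 * \<mu> + 2 * h + (2 * h - 1)) \<le> real (2 * \<mu> + (2 * h - 1) + (2 * h - 1))"
      using up by linarith
    then show False using h unfolding of_nat_le_iff by linarith
  qed
  \<comment> \<open>With \<open>C = (2 * h) choose h \<ge> 2\<close>, there are
    \<open>2 ^ C - 1\<close> nonempty families, more than the at most \<open>2 ^ (C - 1)\<close>
    transcripts.\<close>
  have "(2::nat) \<le> 2 ^ h" using h self_le_power[of "2::nat" h] by simp
  then have "2 \<le> (2 * h) choose h" using two_power_le_central_binomial[OF h] by linarith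
  then obtain r where r: "(2 * h) choose h = Suc (Suc r)" by (metis add_2_eq_Suc le_Suc_ex)
  have "(2::nat) ^ bits \<tau> \<le> 2 ^ Suc r" using bits r by (intro power_increasing) auto
  also have "\<dots> < 2 ^ Suc (Suc r) - 1"
    using one_le_power[of "2::nat" r] unfolding power_Suc by linarith
  also have "\<dots> = card (Pow H - {{}})"
    using finH cardH r by (simp add: card_Diff_subset card_Pow)
  finally obtain \<X> \<X>' where XX: "\<X> \<in> Pow H - {{}}" "\<X>' \<in> Pow H - {{}}" "\<X> \<noteq> \<X>'"
    "transcript \<tau> (prof \<X> (co \<X>)) = transcript \<tau> (prof \<X>' (co \<X>'))"
    by (rule transcript_collision[where h = "\<lambda>\<X>. prof \<X> (co \<X>)"])
  then consider Z where "Z \<in> \<X>" "Z \<notin> \<X>'" | Z where "Z \<in> \<X>'" "Z \<notin> \<X>" by blast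
  then show False
    using collide[of \<X> \<X>'] collide[of \<X>' \<X>] XX by cases auto
qed

section \<open>The lower bounds\<close>

text \<open>When each bidder counts the items meant for him, welfare is the number of items on which
  an allocation agrees with \<open>f\<close>. Delivering every item as meant has welfare
  \<open>m\<close>, so the guarantee becomes a covering property of the bank.\<close>

lemma bank_agreement:
  assumes D: "real ` {0..2 ^ m} \<subseteq> D" and bank: "\<A> \<subseteq> allocations n m" "\<A> \<noteq> {}"
    and approx: "approx_guarantee (submod_profiles D n m) n m \<A> \<alpha>"
    and f: "\<And>x. x < m \<Longrightarrow> f x < n"
  shows "\<exists>A\<in>\<A>. real m / \<alpha> \<le> real (card {x\<in>{..<m}. x \<in> A (f x)})"
proof -
  define w where "w = (\<lambda>i\<in>{..<n}. \<lambda>S\<in>Pow {..<m}. real (card {x\<in>S. f x = i}))"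
  have fin: "finite S" if "S \<subseteq> {..<m}" for S :: "nat set" using that finite_subset by blast
  have "(\<lambda>S\<in>Pow {..<m}. real (card {x\<in>S. f x = i})) \<in> submod_valuations D m" for i
  proof -
    have "real (card {x\<in>S. f x = i}) \<in> D" if "S \<subseteq> {..<m}" for S
    proof -
      have "card {x\<in>S. f x = i} \<le> card {..<m}" using that by (intro card_mono) auto
      also have "\<dots> \<le> 2 ^ m" using less_exp[of m] by simp
      finally show ?thesis using D by auto
    qed
    moreover have "card {x\<in>S. f x = i} \<le> card {x\<in>T. f x = i}" if "S \<subseteq> T" "T \<subseteq> {..<m}" for S T
      using that fin by (intro card_mono) auto
    moreover have "real (card {x\<in>S \<union> T. f x = i}) + real (card {x\<in>S \<inter> T. f x = i})
        = real (card {x\<in>S. f x = i}) + real (card {x\<in>T. f x = i})"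
      if "S \<subseteq> {..<m}" "T \<subseteq> {..<m}" for S T
    proof -
      have "{x\<in>S \<union> T. f x = i} = {x\<in>S. f x = i} \<union> {x\<in>T. f x = i}"
        "{x\<in>S \<inter> T. f x = i} = {x\<in>S. f x = i} \<inter> {x\<in>T. f x = i}" by auto
      then show ?thesis
        using card_Un_Int[of "{x\<in>S. f x = i}" "{x\<in>T. f x = i}"] fin that by simp
    qed
    ultimately show ?thesis
      by (auto simp: submod_valuations_def mono_on_def submodular_on_def le_infI1)
  qed
  then have w: "w \<in> submod_profiles D n m" by (auto simp: submod_profiles_def w_def)
  have welfare: "welfare n w A = real (card {x\<in>{..<m}. x \<in> A (f x)})" if "A \<in> allocations n m" for A
  proof -
    have sub: "A j \<subseteq> {..<m}" if "j < n" for j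
      using \<open>A \<in> allocations n m\<close> that by (auto simp: allocations_def PiE_iff)
    have "welfare n w A = (\<Sum>j<n. real (card {x\<in>A j. f x = j}))"
      unfolding welfare_def using sub by (intro sum.cong) (auto simp: w_def)
    also have "\<dots> = real (card (\<Union>j<n. {x\<in>A j. f x = j}))"
      using sub fin by (subst card_UN_disjoint) auto
    also have "(\<Union>j<n. {x\<in>A j. f x = j}) = {x\<in>{..<m}. x \<in> A (f x)}"
      using sub f by blast
    finally show ?thesis .
  qed
  define B where "B = (\<lambda>i\<in>{..<n}. {x\<in>{..<m}. f x = i})"
  have B: "B \<in> allocations n m"
    by (auto simp: B_def allocations_def disjoint_family_on_def)
  have "{x\<in>{..<m}. x \<in> B (f x)} = {..<m}" using f by (auto simp: B_def)
  then have "real m = welfare n w B" using welfare[OF B] by simp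
  also have "\<dots> \<le> OPT n m w"
    unfolding OPT_def using B finite_allocations by (intro Max_ge) auto
  finally have "real m / \<alpha> \<le> OPT n m w / \<alpha>"
    using approx by (intro divide_right_mono) (auto simp: approx_guarantee_def)
  also have "\<dots> \<le> MIR n \<A> w" using approx w by (auto simp: approx_guarantee_def)
  finally have le: "real m / \<alpha> \<le> MIR n \<A> w" .
  have "MIR n \<A> w \<in> welfare n w ` \<A>"
    unfolding MIR_def using bank finite_subset[OF bank(1) finite_allocations]
    by (intro Max_in) auto
  then obtain A where "A \<in> \<A>" "MIR n \<A> w = welfare n w A" by auto
  then show ?thesis using le welfare[of A] bank(1) by (intro bexI[of _ A]) auto
qed

text \<open>Were the inequality false, the partial assignments realised in the bank would shatter
  more than \<open>(2 * k + 1) * (N - 1)\<close> items. As edges between \<open>p e\<close> and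
  \<open>q e\<close> these contain \<open>2 * k + 2\<close> disjoint links between two bidders, and
  the fooling set with \<open>h = k + 1\<close> needs
  \<open>(2 * k + 2) choose (k + 1) \<ge> 2 ^ (k + 1)\<close> bits.\<close>

lemma agreement_communication_tradeoff:
  assumes D: "real ` {0..2 ^ m} \<subseteq> D"
    and mech: "mir_mechanism (submod_profiles D n m) n m \<A> f"
    and comm: "uses_communication (submod_profiles D n m) n f (2 ^ k)"
    and N: "1 \<le> N" "N \<le> n" and u: "0 < u" "18 * m \<le> N * u"
    and agree: "\<And>g. g \<in> {..<m} \<rightarrow>\<^sub>E {..<N} \<Longrightarrow> \<exists>A\<in>\<A>. u \<le> card {x\<in>{..<m}. x \<in> A (g x)}"
  shows "2 ^ u \<le> N ^ (2 * ((2 * k + 1) * (N - 1)))"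
proof (rule ccontr)
  assume not_le: "\<not> 2 ^ u \<le> N ^ (2 * ((2 * k + 1) * (N - 1)))"
  define F where "F = {g. dom g \<subseteq> {..<m} \<and> ran g \<subseteq> {..<N} \<and>
    (\<exists>A\<in>\<A>. \<forall>x\<in>dom g. x \<in> A (the (g x)))}"
  obtain S p q where S: "shatters F S p q" "S \<subseteq> {..<m}" "p ` S \<subseteq> {..<N}" "q ` S \<subseteq> {..<N}"
    and cardS: "(2 * k + 1) * (N - 1) < card S"
  proof (rule covering_family_shatters[of "{..<m}" "{..<N}" F u "(2 * k + 1) * (N - 1)"])
    show "F \<subseteq> {g. dom g \<subseteq> {..<m} \<and> ran g \<subseteq> {..<N}}" by (auto simp: F_def)
    show "g' \<in> F" if gF: "g \<in> F" and g'g: "g' \<subseteq>\<^sub>m g" for g g'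
    proof -
      obtain A where "dom g \<subseteq> {..<m}" "ran g \<subseteq> {..<N}" "A \<in> \<A>" "\<forall>x\<in>dom g. x \<in> A (the (g x))"
        using gF by (auto simp: F_def)
      moreover have "dom g' \<subseteq> dom g" by (rule map_le_implies_dom_le[OF g'g])
      moreover have "g' x = g x" if "x \<in> dom g'" for x using g'g that by (auto simp: map_le_def)
      moreover have "ran g' \<subseteq> ran g"
        using g'g unfolding ran_def map_le_def by (auto simp: dom_def) (metis option.distinct(1))
      ultimately have "dom g' \<subseteq> {..<m}" "ran g' \<subseteq> {..<N}" "\<forall>x\<in>dom g'. x \<in> A (the (g' x))"
        by (blast, blast, metis subsetD)
      then show ?thesis using \<open>A \<in> \<A>\<close> unfolding F_def by blast
    qed
    show "\<exists>h\<in>F. card (dom h) = u \<and> (\<forall>x\<in>dom h. h x = Some (g x))"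
      if g: "g \<in> {..<m} \<rightarrow>\<^sub>E {..<N}" for g
    proof -
      obtain A where A: "A \<in> \<A>" "u \<le> card {x\<in>{..<m}. x \<in> A (g x)}" using agree[OF g] by auto
      obtain T where T: "T \<subseteq> {x\<in>{..<m}. x \<in> A (g x)}" "card T = u"
        using obtain_subset_with_card_n[OF A(2)] by auto
      define h where "h x = (if x \<in> T then Some (g x) else None)" for x
      have dom: "dom h = T" by (auto simp: h_def dom_def)
      have "h \<in> F"
        unfolding F_def using T(1) A(1) g dom
        by (auto simp: h_def ran_def PiE_iff split: if_splits)
      moreover have "\<forall>x\<in>dom h. h x = Some (g x)" unfolding dom by (simp add: h_def)
      ultimately show ?thesis using dom T(2) by blast
    qed
    show "18 * card {..<m} \<le> card {..<N} * u" using u by simp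
    show "card {..<N} ^ (2 * ((2 * k + 1) * (N - 1))) < 2 ^ u" using not_le by simp
  qed (use u N in \<open>auto simp: lessThan_empty_iff\<close>)
  have pq: "p e < N" "q e < N" "p e \<noteq> q e" if "e \<in> S" for e
    using S that by (auto simp: shatters_def)
  have "finite S" using S(2) finite_subset by blast
  define L where "L = (\<lambda>e. ({e}, p e, q e)) ` S"
  have cardL: "card L = card S"
    unfolding L_def by (rule card_image) (auto simp: inj_on_def)
  have "\<exists>u v \<I>. u \<noteq> v \<and> finite \<I> \<and> card \<I> = Suc (2 * k + 1) \<and> disjoint \<I> \<and>
    (\<forall>I\<in>\<I>. linked n p q I u v \<and> I \<subseteq> S)"
  proof (rule bundle_of_links[of "{..<N}" "2 * k + 1" L])
    show "linked n p q I i j \<and> i \<in> {..<N} \<and> j \<in> {..<N} \<and> i \<noteq> j \<and> I \<subseteq> S"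
      if L: "(I, i, j) \<in> L" for I i j
    proof -
      obtain e where e: "e \<in> S" "I = {e}" "i = p e" "j = q e" using L by (auto simp: L_def)
      then show ?thesis using linked_single[of p e n q] pq[OF e(1)] N by auto
    qed
    show "(2 * k + 1) * (card {..<N} - 1) < card L" using cardL cardS by simp
  qed (use N \<open>finite S\<close> in \<open>auto simp: L_def lessThan_empty_iff\<close>)
  then obtain u v \<I> where I: "u \<noteq> v" "finite \<I>" "card \<I> = Suc (2 * k + 1)" "disjoint \<I>"
    "\<And>I. I \<in> \<I> \<Longrightarrow> linked n p q I u v \<and> I \<subseteq> S" by blast
  obtain \<tau> :: "(nat, valuation, allocation) protocol" where \<tau>: "bits \<tau> \<le> 2 ^ k"
    "\<And>w. w \<in> submod_profiles D n m \<Longrightarrow> run \<tau> w = f w"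
    using comm unfolding uses_communication_def by blast
  have "(2 * Suc k) choose (Suc k) \<le> bits \<tau>"
  proof (rule linked_pair_communication[of \<I> "Suc k" n p q u v m D \<A> f \<tau>])
    show "\<exists>A\<in>\<A>. \<forall>t\<in>\<Union>\<I>. t \<in> A (a t)" if a: "\<And>t. t \<in> \<Union>\<I> \<Longrightarrow> a t = p t \<or> a t = q t" for a
    proof -
      \<comment> \<open>Shattering speaks of assignments on all of \<open>S\<close>, so items
        outside the links get the arbitrary choice \<open>p\<close>.\<close>
      define g where "g t = (if t \<in> \<Union>\<I> then Some (a t) else if t \<in> S then Some (p t) else None)" for t
      have sub: "\<Union>\<I> \<subseteq> S" using I(5) by auto
      have "g \<in> F"
      proof -
        have "dom g = S" using sub by (auto simp: g_def dom_def split: if_splits)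
        moreover have "\<forall>x\<in>S. g x = Some (p x) \<or> g x = Some (q x)"
          using a by (auto simp: g_def)
        ultimately show ?thesis using S(1) unfolding shatters_def by blast
      qed
      then obtain A where A: "A \<in> \<A>" "\<forall>x\<in>dom g. x \<in> A (the (g x))" by (auto simp: F_def)
      have "t \<in> A (a t)" if "t \<in> \<Union>\<I>" for t
      proof -
        have "g t = Some (a t)" using that by (simp add: g_def)
        then show ?thesis using A(2) by (metis domI option.sel)
      qed
      then show ?thesis using A(1) by blast
    qed
    show "linked n p q I u v \<and> I \<subseteq> {..<m}" if "I \<in> \<I>" for I using I(5)[OF that] S(2) by blast
  qed (use I D mech \<tau> in \<open>auto simp: mir_mechanism_def allocation_bank_def\<close>)
  moreover have "2 ^ Suc k \<le> (2 * Suc k) choose (Suc k)"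
    by (rule two_power_le_central_binomial) simp
  ultimately have "(2::nat) ^ Suc k \<le> 2 ^ k" using \<tau>(1) by linarith
  then show False by simp
qed

text \<open>If \<open>36 * \<alpha> < B\<close>, take \<open>N = \<lfloor>B\<rfloor>\<close> bidders
  and \<open>u = \<lceil>m / \<alpha>\<rceil>\<close>. Then \<open>18 * \<alpha> \<le> N\<close>
  makes the agreement dense enough, and \<open>B \<le> sqrt (m / k) \<le> n\<close> makes the
  bidders available and gives \<open>log 2 N \<le> l / 2\<close>. The tradeoff yields
  \<open>m / \<alpha> \<le> 3 * k * B * l\<close>, hence
  \<open>m \<le> B ^ 2 * k * l / 12 = m / 12\<close>.\<close>

lemma mir_submod_lower_bound:
  assumes k: "1 \<le> k" "real k \<le> real m / 2" and n: "sqrt (real m / real k) \<le> real n"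
    and D: "real ` {0..2 ^ m} \<subseteq> D"
    and mech: "mir_mechanism (submod_profiles D n m) n m \<A> f"
    and comm: "uses_communication (submod_profiles D n m) n f (2 ^ k)"
    and approx: "approx_guarantee (submod_profiles D n m) n m \<A> \<alpha>"
  shows "sqrt (real m / (real k * log 2 (real m / real k))) / 36 \<le> \<alpha>"
proof (rule ccontr)
  define l where "l = log 2 (real m / real k)"
  define B where "B = sqrt (real m / (real k * l))"
  assume "\<not> ?thesis"
  then have small: "36 * \<alpha> < B" by (simp add: B_def l_def)
  have bank: "\<A> \<subseteq> allocations n m" "\<A> \<noteq> {}"
    using mech by (auto simp: mir_mechanism_def allocation_bank_def)
  have mk: "2 \<le> real m / real k" "0 < real m" "0 < real k" using k by (auto simp: field_simps)
  have l1: "1 \<le> l" using mk unfolding l_def by (simp add: le_log_iff)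
  have apos: "0 < \<alpha>" using approx by (simp add: approx_guarantee_def)
  have "1 \<le> sqrt (real m / real k)" using mk(1) by (intro real_sqrt_ge_one) linarith
  then have n1: "1 \<le> n" using n by linarith
  \<comment> \<open>Assigning all items to bidder \<open>0\<close> shows
    \<open>\<alpha> \<ge> 1\<close>, since no allocation agrees on more than \<open>m\<close> items.
    Hence \<open>B > 36\<close>, and rounding \<open>B\<close> down costs at most half of
    it.\<close>
  obtain A where "real m / \<alpha> \<le> real (card {x\<in>{..<m}. x \<in> A ((\<lambda>_. 0) x)})"
    using bank_agreement[OF D bank approx, of "\<lambda>_. 0"] n1 by auto
  also have "\<dots> \<le> real (card {..<m})" by (intro of_nat_mono card_mono) auto
  finally have a1: "1 \<le> \<alpha>" using mk apos by (simp add: field_simps)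
  define N where "N = nat \<lfloor>B\<rfloor>"
  define u where "u = nat \<lceil>real m / \<alpha>\<rceil>"
  have B36: "36 < B" using small a1 by linarith
  then have N: "real N \<le> B" "B < real N + 1" by (auto simp: N_def)
  have "1 < real N" using N B36 by linarith
  have u_ge: "real m / \<alpha> \<le> real u" unfolding u_def by (rule real_nat_ceiling_ge)
  have Bsqrt: "B \<le> sqrt (real m / real k)"
    unfolding B_def using mk l1 by (intro real_sqrt_le_mono divide_left_mono) auto
  have B2: "B ^ 2 * (real k * l) = real m"
    using mk l1 by (simp add: B_def)
  have "real (18 * m) \<le> real (N * u)"
  proof -
    have "18 * real m * \<alpha> \<le> real N * real m"
    proof -
      have "18 * \<alpha> \<le> real N" using small N \<open>1 < real N\<close> by linarith
      then show ?thesis using mk by (simp add: mult.commute mult_left_mono)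
    qed
    then have "18 * real m \<le> real N * (real m / \<alpha>)" using apos by (simp add: field_simps)
    also have "\<dots> \<le> real N * real u" using u_ge by (intro mult_left_mono) auto
    finally show ?thesis by simp
  qed
  then have Nu: "18 * m \<le> N * u" by linarith
  have "2 ^ u \<le> N ^ (2 * ((2 * k + 1) * (N - 1)))"
  proof (rule agreement_communication_tradeoff[OF D mech comm _ _ _ Nu])
    show "1 \<le> N" using \<open>1 < real N\<close> by simp
    show Nn: "N \<le> n" using N(1) Bsqrt n by linarith
    show "0 < u" using u_ge mk apos by (metis divide_pos_pos gr0I not_le of_nat_0)
    show "\<exists>A\<in>\<A>. u \<le> card {x\<in>{..<m}. x \<in> A (g x)}" if "g \<in> {..<m} \<rightarrow>\<^sub>E {..<N}" for g
    proof -
      have "g x < n" if "x < m" for x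
        using PiE_mem[OF \<open>g \<in> {..<m} \<rightarrow>\<^sub>E {..<N}\<close>, of x] that Nn by simp
      from bank_agreement[OF D bank approx, of g, OF this] show ?thesis
        by (auto simp: u_def nat_le_iff ceiling_le_iff)
    qed
  qed
  then have "real (2 ^ u) \<le> real (N ^ (2 * ((2 * k + 1) * (N - 1))))" by (rule of_nat_mono)
  then have "log 2 (2 ^ u) \<le> log 2 (real N ^ (2 * ((2 * k + 1) * (N - 1))))"
    using \<open>1 < real N\<close> by (subst log_le_cancel_iff) auto
  then have "real u \<le> real (2 * ((2 * k + 1) * (N - 1))) * log 2 (real N)"
    using \<open>1 < real N\<close> by (simp add: log_nat_power)
  also have "\<dots> \<le> (6 * real k * B) * (l / 2)"
  proof (rule mult_mono)
    have "(2 * k + 1) * (N - 1) \<le> (3 * k) * N" using k by (intro mult_mono) auto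
    then have "2 * ((2 * k + 1) * (N - 1)) \<le> 6 * k * N" by simp
    then have "real (2 * ((2 * k + 1) * (N - 1))) \<le> real (6 * k * N)" by (rule of_nat_mono)
    also have "\<dots> \<le> 6 * real k * B" using N by (simp add: mult_left_mono)
    finally show "real (2 * ((2 * k + 1) * (N - 1))) \<le> 6 * real k * B" .
    have "real N \<le> sqrt (real m / real k)" using N(1) Bsqrt by linarith
    then have "log 2 (real N) \<le> log 2 (sqrt (real m / real k))"
      using \<open>1 < real N\<close> mk by (subst log_le_cancel_iff) auto
    also have "\<dots> = l / 2"
      using mk by (simp add: l_def log_def ln_sqrt)
    finally show "log 2 (real N) \<le> l / 2" .
  qed (use B36 \<open>1 < real N\<close> in auto)
  finally have "real m / \<alpha> \<le> 3 * real k * B * l" using u_ge by (simp add: mult_ac)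
  then have "real m \<le> 3 * real k * B * l * \<alpha>" using apos by (simp add: field_simps)
  also have "\<dots> = 3 * real k * B * l / 36 * (36 * \<alpha>)" by simp
  also have "\<dots> \<le> 3 * real k * B * l / 36 * B"
    using small B36 l1 mk by (intro mult_left_mono) auto
  also have "\<dots> = B ^ 2 * (real k * l) / 12" by (simp add: power2_eq_square)
  finally show False using mk B2 by simp
qed

section \<open>Polynomial communication\<close>

lemma poly_nat_le_power:
  fixes p :: "nat poly"
  assumes "(\<Sum>i\<le>degree p. coeff p i) \<le> m" "1 \<le> m"
  shows "poly p m \<le> m ^ Suc (degree p)"
proof -
  have "poly p m = (\<Sum>i\<le>degree p. coeff p i * m ^ i)" by (rule poly_altdef)
  also have "\<dots> \<le> (\<Sum>i\<le>degree p. coeff p i * m ^ degree p)"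
    using assms(2) by (intro sum_mono mult_left_mono power_increasing) auto
  also have "\<dots> = (\<Sum>i\<le>degree p. coeff p i) * m ^ degree p" by (simp add: sum_distrib_right)
  also have "\<dots> \<le> m * m ^ degree p" using assms(1) by (rule mult_right_mono) simp
  finally show ?thesis by simp
qed

lemma uses_communication_mono:
  "uses_communication \<V> n f b \<Longrightarrow> b \<le> b' \<Longrightarrow> uses_communication \<V> n f b'"
  unfolding uses_communication_def by (meson le_trans)

text \<open>For \<open>m\<close> at least the sum of the coefficients,
  \<open>poly p m \<le> m ^ a\<close> with \<open>a = degree p + 1\<close>, so \<open>2 ^ k\<close>
  bits with \<open>k = \<lceil>a * log 2 m\<rceil>\<close> cover the budget. As
  \<open>k \<le> (a + 1) * log 2 m\<close> and \<open>log 2 (m / k) \<le> log 2 m\<close>, the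
  general bound becomes \<open>sqrt m / log 2 m\<close> up to the factor
  \<open>1 / (36 * sqrt (a + 1))\<close>.\<close>

lemma polynomial_communication_lower_bound:
  fixes p :: "nat poly"
  obtains c' m\<^sub>0 where "c' > 0"
    "\<And>m n D \<A> f \<alpha>. m \<ge> m\<^sub>0 \<Longrightarrow> sqrt (real m / log 2 (real m)) \<le> real n \<Longrightarrow>
      real ` {0..2 ^ m} \<subseteq> D \<Longrightarrow> mir_mechanism (submod_profiles D n m) n m \<A> f \<Longrightarrow>
      uses_communication (submod_profiles D n m) n f (poly p m) \<Longrightarrow>
      approx_guarantee (submod_profiles D n m) n m \<A> \<alpha> \<Longrightarrow>
      c' * sqrt (real m) / log 2 (real m) \<le> \<alpha>"
proof -
  define a where "a = Suc (degree p)"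
  \<comment> \<open>This keeps the rounded-up \<open>k\<close> at most \<open>m / 2\<close>.\<close>
  have "eventually (\<lambda>m::nat. real a * log 2 (real m) + 1 \<le> real m / 2) at_top"
    by real_asymp
  then obtain m1 where m1: "\<And>m. m1 \<le> m \<Longrightarrow> real a * log 2 (real m) + 1 \<le> real m / 2"
    unfolding eventually_at_top_linorder by blast
  define m\<^sub>0 where "m\<^sub>0 = max m1 (max 2 (\<Sum>i\<le>degree p. coeff p i))"
  define c' where "c' = 1 / (36 * sqrt (real a + 1))"
  show ?thesis
  proof (rule that[of c' m\<^sub>0])
    show "c' > 0" by (simp add: c'_def)
    fix m n :: nat and D :: "real set" and \<A> f \<alpha>
    assume m: "m\<^sub>0 \<le> m" and n: "sqrt (real m / log 2 (real m)) \<le> real n"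
      and D: "real ` {0..2 ^ m} \<subseteq> D" and mech: "mir_mechanism (submod_profiles D n m) n m \<A> f"
      and comm: "uses_communication (submod_profiles D n m) n f (poly p m)"
      and approx: "approx_guarantee (submod_profiles D n m) n m \<A> \<alpha>"
    have m2: "2 \<le> m" and pm: "poly p m \<le> m ^ a"
      using m poly_nat_le_power[of p m] by (auto simp: m\<^sub>0_def a_def)
    define l where "l = log 2 (real m)"
    have l1: "1 \<le> l" using m2 by (simp add: l_def le_log_iff)
    define k where "k = nat \<lceil>real a * l\<rceil>"
    have "1 * 1 \<le> real a * l" using l1 by (intro mult_mono) (auto simp: a_def)
    then have al: "1 \<le> real a * l" by simp
    have kl: "real a * l \<le> real k" "real k \<le> real a * l + 1" using al by (auto simp: k_def)
    have k1: "1 \<le> k" using kl al by linarith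
    have km: "real k \<le> real m / 2" using kl m1[of m] m by (simp add: m\<^sub>0_def l_def)
    \<comment> \<open>Since \<open>k \<ge> log 2 m\<close>, the assumed number of bidders is at
      least \<open>sqrt (m / k)\<close>.\<close>
    have "l \<le> real a * l" using l1 by (simp add: a_def)
    then have lk: "l \<le> real k" using kl by linarith
    have "real (m ^ a) = 2 powr (real a * l)"
    proof -
      have "2 powr (real a * l) = (2 powr l) powr real a" by (simp add: powr_powr mult.commute)
      also have "2 powr l = real m" using m2 by (simp add: l_def)
      finally show ?thesis using m2 by (simp add: powr_realpow)
    qed
    also have "\<dots> \<le> 2 powr real k" using kl by (intro powr_mono) auto
    also have "\<dots> = real (2 ^ k)" by (simp add: powr_realpow)
    finally have "m ^ a \<le> 2 ^ k" by (simp only: of_nat_le_iff)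
    then have "poly p m \<le> 2 ^ k" using pm by linarith
    then have comm': "uses_communication (submod_profiles D n m) n f (2 ^ k)"
      by (rule uses_communication_mono[OF comm])
    have "sqrt (real m / real k) \<le> sqrt (real m / l)"
      using lk l1 by (intro real_sqrt_le_mono divide_left_mono) auto
    from order_trans[OF this n[folded l_def]] have n': "sqrt (real m / real k) \<le> real n" .
    define l' where "l' = log 2 (real m / real k)"
    have mk: "2 \<le> real m / real k" using km k1 by (simp add: field_simps)
    have l': "1 \<le> l'" "l' \<le> l"
    proof -
      show "1 \<le> l'" using mk by (simp add: l'_def le_log_iff)
      have "real m / real k \<le> real m / 1" using k1 by (intro divide_left_mono) auto
      then have "real m / real k \<le> real m" by simp
      then show "l' \<le> l" unfolding l'_def l_def using mk m2 by (subst log_le_cancel_iff) auto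
    qed
    have "real k * l' \<le> ((real a + 1) * l) * l"
      using kl l1 l' by (intro mult_mono) (auto simp: algebra_simps)
    moreover have "0 < real k * l'" using k1 l' by simp
    ultimately have le: "sqrt (real m / (((real a + 1) * l) * l)) \<le> sqrt (real m / (real k * l'))"
      by (intro real_sqrt_le_mono divide_left_mono mult_pos_pos) (use l1 l' k1 in auto)
    have "sqrt (real m) / (sqrt (real a + 1) * l) = sqrt (real m / (((real a + 1) * l) * l))"
      using l1 by (simp add: real_sqrt_divide real_sqrt_mult mult.assoc)
    then have "sqrt (real m) / (sqrt (real a + 1) * l) / 36 \<le> sqrt (real m / (real k * l')) / 36"
      using divide_right_mono[OF le, of 36] by simp
    also have "\<dots> \<le> \<alpha>"
      unfolding l'_def by (rule mir_submod_lower_bound[OF k1 km n' D mech comm' approx])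
    finally have "sqrt (real m) / (sqrt (real a + 1) * l) / 36 \<le> \<alpha>" .
    then show "c' * sqrt (real m) / log 2 (real m) \<le> \<alpha>"
      unfolding l_def[symmetric] by (simp add: c'_def mult_ac)
  qed
qed

theorem theorem1p2:
  "\<exists>C c :: real. C > 0 \<and> c > 0 \<and>
     (\<forall>(m::nat) (k::nat) (n::nat) (D::real set).
        C * log 2 (real m) \<le> real k \<longrightarrow> real k \<le> real m / 2 \<longrightarrow>
        C * sqrt (real m / real k) \<le> real n \<longrightarrow>
        real ` {0..2 ^ m} \<subseteq> D \<longrightarrow> D \<subseteq> {0..} \<longrightarrow>
        ereal (c * sqrt (real m / (real k * log 2 (real m / real k)))) \<le> MIR_SubMod D n m k \<and>
        (\<forall>\<A> f \<alpha>.
           mir_mechanism (submod_profiles D n m) n m \<A> f \<longrightarrow>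
           uses_communication (submod_profiles D n m) n f (2 ^ k) \<longrightarrow>
           approx_guarantee (submod_profiles D n m) n m \<A> \<alpha> \<longrightarrow>
           c * sqrt (real m / (real k * log 2 (real m / real k))) \<le> \<alpha>)) \<and>
     (\<forall>p :: nat poly. \<exists>c'>0. \<exists>m\<^sub>0::nat. \<forall>m\<ge>m\<^sub>0. \<forall>(n::nat) (D::real set).
        C * sqrt (real m / log 2 (real m)) \<le> real n \<longrightarrow>
        real ` {0..2 ^ m} \<subseteq> D \<longrightarrow> D \<subseteq> {0..} \<longrightarrow>
        (\<forall>\<A> f \<alpha>.
           mir_mechanism (submod_profiles D n m) n m \<A> f \<longrightarrow>
           uses_communication (submod_profiles D n m) n f (poly p m) \<longrightarrow>
           approx_guarantee (submod_profiles D n m) n m \<A> \<alpha> \<longrightarrow>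
           c' * sqrt (real m) / log 2 (real m) \<le> \<alpha>))"
proof (rule exI[of _ 1], rule exI[of _ "1 / 36"], intro conjI allI impI)
  fix m k n :: nat and D :: "real set"
  assume k: "real k \<le> real m / 2" and n: "1 * sqrt (real m / real k) \<le> real n"
    and D: "real ` {0..2 ^ m} \<subseteq> D"
  show bound: "1 / 36 * sqrt (real m / (real k * log 2 (real m / real k))) \<le> \<alpha>"
    if "mir_mechanism (submod_profiles D n m) n m \<A> f"
      "uses_communication (submod_profiles D n m) n f (2 ^ k)"
      "approx_guarantee (submod_profiles D n m) n m \<A> \<alpha>" for \<A> f \<alpha>
  \<comment> \<open>\<open>k = 0\<close> is possible for \<open>m \<le> 1\<close>. Division by zero
    then makes the claimed bound \<open>0\<close>, which is below the positive
    \<open>\<alpha>\<close>.\<close>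
  proof (cases "k = 0")
    case True
    then show ?thesis using that(3) by (simp add: approx_guarantee_def)
  next
    case False
    then show ?thesis using mir_submod_lower_bound[OF _ k _ D that] n by simp
  qed
  show "ereal (1 / 36 * sqrt (real m / (real k * log 2 (real m / real k)))) \<le> MIR_SubMod D n m k"
    unfolding MIR_SubMod_def
  proof (rule Inf_greatest)
    fix r
    assume "r \<in> {ereal \<alpha> | \<alpha> \<A> f. mir_mechanism (submod_profiles D n m) n m \<A> f
      \<and> uses_communication (submod_profiles D n m) n f (2 ^ k)
      \<and> approx_guarantee (submod_profiles D n m) n m \<A> \<alpha>}"
    then obtain \<alpha> \<A> f where r: "r = ereal \<alpha>"
      and *: "mir_mechanism (submod_profiles D n m) n m \<A> f"
        "uses_communication (submod_profiles D n m) n f (2 ^ k)"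
        "approx_guarantee (submod_profiles D n m) n m \<A> \<alpha>" by blast
    show "ereal (1 / 36 * sqrt (real m / (real k * log 2 (real m / real k)))) \<le> r"
      unfolding r ereal_less_eq using bound[OF *] .
  qed
next
  fix p :: "nat poly"
  obtain c' m\<^sub>0 where "c' > 0" and
    "\<And>m n D \<A> f \<alpha>. m \<ge> m\<^sub>0 \<Longrightarrow> sqrt (real m / log 2 (real m)) \<le> real n \<Longrightarrow>
      real ` {0..2 ^ m} \<subseteq> D \<Longrightarrow> mir_mechanism (submod_profiles D n m) n m \<A> f \<Longrightarrow>
      uses_communication (submod_profiles D n m) n f (poly p m) \<Longrightarrow>
      approx_guarantee (submod_profiles D n m) n m \<A> \<alpha> \<Longrightarrow>
      c' * sqrt (real m) / log 2 (real m) \<le> \<alpha>"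
    using polynomial_communication_lower_bound[of p] by metis
  then show "\<exists>c'>0. \<exists>m\<^sub>0::nat. \<forall>m\<ge>m\<^sub>0. \<forall>(n::nat) (D::real set).
        1 * sqrt (real m / log 2 (real m)) \<le> real n \<longrightarrow>
        real ` {0..2 ^ m} \<subseteq> D \<longrightarrow> D \<subseteq> {0..} \<longrightarrow>
        (\<forall>\<A> f \<alpha>.
           mir_mechanism (submod_profiles D n m) n m \<A> f \<longrightarrow>
           uses_communication (submod_profiles D n m) n f (poly p m) \<longrightarrow>
           approx_guarantee (submod_profiles D n m) n m \<A> \<alpha> \<longrightarrow>
           c' * sqrt (real m) / log 2 (real m) \<le> \<alpha>)"
    by (intro exI[of _ c'] conjI exI[of _ m\<^sub>0]) simp_all
qed simp_all

end
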